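(* Let $G\leq \operatorname{Homeo}(\mathfrak{C})$ be finitely generated, simple and vigorous, and let $n\geq 2$ be an integer. Then there exist $\sigma,\zeta\in G$ such that $\sigma$ has finite order, $\zeta$ has order exactly $n$, and $\langle \sigma,\zeta\rangle = G$.
   Context: $\mathfrak{C}$ denotes a Cantor space (a space homeomorphic to $\{0,1\}^\omega$). Groups of homeomorphisms act on the right, and products are composed left to right. $K_{\mathfrak{C}}$ denotes the set of non-empty proper clopen subsets of $\mathfrak{C}$. For $\gamma\in\operatorname{Homeo}(\mathfrak{C})$, $\operatorname{supp}(\gamma)=\{p\in\mathfrak{C}: p\gamma\neq p\}$. A subset $S\subseteq \operatorname{Homeo}(\mathfrak{C})$ is vigorous if for all clopen $A,B,C\subseteq\mathfrak{C}$ with $B,C$ non-empty proper subsets of $A$ there is $\gamma\in S$ with $\operatorname{supp}(\gamma)\subseteq A$ and $B\gamma\subseteq C$. *)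

theory Defs
  imports "HOL-Analysis.Analysis" "HOL-Algebra.Algebra"
begin

definition cantor_top :: "(nat \<Rightarrow> bool) topology" where
  "cantor_top = product_topology (\<lambda>_. discrete_topology (UNIV :: bool set)) UNIV"

definition is_cantor_space :: "'a topology \<Rightarrow> bool" where
  "is_cantor_space T \<longleftrightarrow> T homeomorphic_space cantor_top"

text \<open>Homeomorphisms of T, normalised to be the identity outside the topspace,
  so that equality of homeomorphisms is equality of functions.\<close>
definition Homeo :: "'a topology \<Rightarrow> ('a \<Rightarrow> 'a) set" where
  "Homeo T = {f. homeomorphic_map T T f \<and> (\<forall>x. x \<notin> topspace T \<longrightarrow> f x = x)}"

text \<open>The group Homeo(T), acting on the right: the product f g means first f, then g.\<close>
definition homeo_group :: "'a topology \<Rightarrow> ('a \<Rightarrow> 'a) monoid" where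
  "homeo_group T = \<lparr>carrier = Homeo T, mult = (\<lambda>f g. g \<circ> f), one = id\<rparr>"

definition supp :: "'a topology \<Rightarrow> ('a \<Rightarrow> 'a) \<Rightarrow> 'a set" where
  "supp T \<gamma> = {p \<in> topspace T. \<gamma> p \<noteq> p}"

definition clopen_in :: "'a topology \<Rightarrow> 'a set \<Rightarrow> bool" where
  "clopen_in T A \<longleftrightarrow> openin T A \<and> closedin T A"

definition vigorous :: "'a topology \<Rightarrow> ('a \<Rightarrow> 'a) set \<Rightarrow> bool" where
  "vigorous T S \<longleftrightarrow>
    (\<forall>A B C. clopen_in T A \<and> clopen_in T B \<and> clopen_in T C \<and>
       B \<noteq> {} \<and> B \<subset> A \<and> C \<noteq> {} \<and> C \<subset> A \<longrightarrow>
       (\<exists>\<gamma>\<in>S. supp T \<gamma> \<subseteq> A \<and> \<gamma> ` B \<subseteq> C))"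

text \<open>Simplicity for possibly infinite groups (the library's simple_group uses
  card of the carrier and is only meaningful for finite groups).\<close>
definition simple_grp :: "('a, 'b) monoid_scheme \<Rightarrow> bool" where
  "simple_grp G \<longleftrightarrow> group G \<and> carrier G \<noteq> {\<one>\<^bsub>G\<^esub>} \<and>
     (\<forall>N. N \<lhd> G \<longrightarrow> N = {\<one>\<^bsub>G\<^esub>} \<or> N = carrier G)"

definition finitely_generated :: "('a, 'b) monoid_scheme \<Rightarrow> bool" where
  "finitely_generated G \<longleftrightarrow> (\<exists>S. finite S \<and> S \<subseteq> carrier G \<and> generate G S = carrier G)"

end

(* If the supports of f and g meet only in I, and f, g both move I off itself, then the commutator
   [f, g] is a 3-cycle on I, f I, g I. Vigor provides such f and g, so G realises the even
   permutations of suitable families of disjoint clopen pieces; in particular G contains elements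
   of every finite order n.

   Let Q, E be proper clopen sets that cover the space and meet. Commutators of elements of order 3
   supported in Q, or in E, already move every proper clopen set into Q; by simplicity all these
   commutators together generate G. Take zeta of order n, R a small clopen set with R and zeta R
   disjoint, Q the complement of R, and E = zeta Q. Since G is finitely generated, it is generated
   by zeta and finitely many commutators [f i, f k] with f i of order 3 and supported in Q.

   Choose pi in G permuting pieces X 0 = Q, X 1, ..., X (p-1) cyclically, where all pieces but the
   first lie in R. As zeta maps R into Q, copies of the f i can be placed on the disjoint subsets
   zeta (X (3^i)) of Q; let phi be their product, and sigma = phi pi. Then sigma^p acts on every
   piece as a copy of phi, and its conjugate by zeta sigma^(3^i) acts on Q as f i. Because
   {0} together with the powers of 3 is a Sidon set, two such conjugates, for i and k distinct, have
   supports that meet only in Q, so their commutator is [f i, f k]. *)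

theory Submission
  imports Defs
begin

(* From here on, inv is the inverse function, not the group inverse of HOL-Algebra. *)
unbundle no m_inv_syntax

section \<open>Groups of functions and generated subgroups\<close>

definition commutator :: "('a \<Rightarrow> 'a) \<Rightarrow> ('a \<Rightarrow> 'a) \<Rightarrow> 'a \<Rightarrow> 'a" where
  "commutator f g = f \<circ> g \<circ> inv f \<circ> inv g"

text \<open>Unlike \<open>supp\<close>, this ranges over the whole type, so it also pins
  \<open>f\<close> down outside the space.\<close>

definition supported_in :: "'a set \<Rightarrow> ('a \<Rightarrow> 'a) \<Rightarrow> bool" where
  "supported_in A f \<longleftrightarrow> (\<forall>t. t \<notin> A \<longrightarrow> f t = t)"

text \<open>Multiplication is \<open>\<circ>\<close>, the opposite of the product of
  \<open>homeo_group\<close>; a group and its opposite have the same subgroups and the same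
  generated subgroups.\<close>

definition fun_group :: "('a \<Rightarrow> 'a) set \<Rightarrow> bool" where
  "fun_group H \<longleftrightarrow> id \<in> H \<and> (\<forall>f\<in>H. inv f \<in> H) \<and> (\<forall>f\<in>H. \<forall>g\<in>H. f \<circ> g \<in> H)"

definition gen :: "('a \<Rightarrow> 'a) set \<Rightarrow> ('a \<Rightarrow> 'a) set" where
  "gen S = \<Inter>{H. S \<subseteq> H \<and> fun_group H}"

lemma fun_group_funpow: "fun_group H \<Longrightarrow> f \<in> H \<Longrightarrow> f ^^ k \<in> H"
  by (induction k) (auto simp: fun_group_def simp del: id_apply)

lemma fun_group_gen: "fun_group (gen S)"
  unfolding gen_def fun_group_def by blast

lemma gen_incl: "S \<subseteq> gen S"
  unfolding gen_def by blast

lemma gen_least: "S \<subseteq> H \<Longrightarrow> fun_group H \<Longrightarrow> gen S \<subseteq> H"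
  unfolding gen_def by blast

lemma gen_mono: "S \<subseteq> S' \<Longrightarrow> gen S \<subseteq> gen S'"
  unfolding gen_def by blast

lemma fun_group_commutator:
  assumes "fun_group H" "f \<in> H" "g \<in> H"
  shows "commutator f g \<in> H"
  using assms unfolding fun_group_def commutator_def by blast

text \<open>The elements generated by finite parts of \<open>S\<close> form a group, since the union
  of two finite parts serves a product; this group contains \<open>S\<close>.\<close>

lemma gen_finite_subset:
  assumes "f \<in> gen S"
  shows "\<exists>F \<subseteq> S. finite F \<and> f \<in> gen F"
proof -
  let ?H = "{f. \<exists>F \<subseteq> S. finite F \<and> f \<in> gen F}"
  have "fun_group ?H"
    unfolding fun_group_def
  proof (intro conjI ballI)
    show "id \<in> ?H"
      using fun_group_gen[of "{}"] unfolding fun_group_def by blast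
    show "inv f \<in> ?H" if "f \<in> ?H" for f
      using that fun_group_gen unfolding fun_group_def by blast
    show "f \<circ> g \<in> ?H" if "f \<in> ?H" "g \<in> ?H" for f g
    proof -
      obtain F F' where F: "F \<subseteq> S" "finite F" "f \<in> gen F" "F' \<subseteq> S" "finite F'" "g \<in> gen F'"
        using \<open>f \<in> ?H\<close> \<open>g \<in> ?H\<close> by blast
      then have "f \<in> gen (F \<union> F')" "g \<in> gen (F \<union> F')"
        using gen_mono[of F "F \<union> F'"] gen_mono[of F' "F \<union> F'"] by auto
      then have "f \<circ> g \<in> gen (F \<union> F')"
        using fun_group_gen unfolding fun_group_def by blast
      moreover have "F \<union> F' \<subseteq> S" "finite (F \<union> F')" using F by auto
      ultimately show ?thesis by blast
    qed
  qed
  moreover have "S \<subseteq> ?H"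
  proof
    fix s assume "s \<in> S"
    then have "{s} \<subseteq> S" "finite {s}" "s \<in> gen {s}" using gen_incl[of "{s}"] by auto
    then show "s \<in> ?H" by blast
  qed
  ultimately show ?thesis using gen_least[of S ?H] assms by blast
qed

lemma gen_finite_finite_subset:
  assumes "finite S" "S \<subseteq> gen S'"
  shows "\<exists>F \<subseteq> S'. finite F \<and> S \<subseteq> gen F"
  using assms
proof (induction S)
  case (insert s S)
  then obtain F where F: "F \<subseteq> S'" "finite F" "S \<subseteq> gen F" by auto
  obtain F' where F': "F' \<subseteq> S'" "finite F'" "s \<in> gen F'"
    using gen_finite_subset insert.prems by (metis insert_subset)
  have "gen F \<subseteq> gen (F \<union> F')" "gen F' \<subseteq> gen (F \<union> F')"
    by (simp_all add: gen_mono)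
  then have "insert s S \<subseteq> gen (F \<union> F')" using F F' by blast
  then show ?case using F F' by (intro exI[of _ "F \<union> F'"]) auto
qed auto

section \<open>Supports and conjugation\<close>

lemma supported_in_fix: "supported_in A f \<Longrightarrow> t \<notin> A \<Longrightarrow> f t = t"
  by (simp add: supported_in_def)

lemma supported_in_mono: "supported_in A f \<Longrightarrow> A \<subseteq> B \<Longrightarrow> supported_in B f"
  by (auto simp: supported_in_def)

lemma supported_in_comp:
  "supported_in A f \<Longrightarrow> supported_in A g \<Longrightarrow> supported_in A (f \<circ> g)"
  by (simp add: supported_in_def)

lemma supported_in_inv:
  assumes "supported_in A f" "bij f" shows "supported_in A (inv f)"
  unfolding supported_in_def
  by (metis assms bij_inv_eq_iff supported_in_fix)

text \<open>A point of \<open>A\<close> sent outside \<open>A\<close> would land on a fixed point,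
  which injectivity forbids. The same holds for the inverse, whence equality.\<close>

lemma supported_in_image:
  assumes "supported_in A f" "bij f" shows "f ` A = A"
proof -
  have "f t \<in> A" if "supported_in A f" "bij f" "t \<in> A" for f t
    using that by (metis bij_pointE supported_in_fix)
  then show ?thesis
    using assms supported_in_inv[OF assms] bij_imp_bij_inv[OF assms(2)]
    by (metis bij_inv_eq_iff image_eqI image_subsetI subsetI subset_antisym)
qed

lemma supported_in_conj:
  assumes "supported_in A f" "bij m" "m ` A \<subseteq> B"
  shows "supported_in B (m \<circ> f \<circ> inv m)"
  unfolding supported_in_def
proof (intro allI impI)
  fix t assume "t \<notin> B"
  then have "inv m t \<notin> A"
    using assms by (metis bij_inv_eq_iff image_subset_iff)
  then show "(m \<circ> f \<circ> inv m) t = t"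
    using assms by (simp add: supported_in_fix bij_is_surj surj_f_inv_f)
qed

lemma conj_comp:
  assumes "bij m"
  shows "(m \<circ> f \<circ> inv m) \<circ> (m \<circ> g \<circ> inv m) = m \<circ> (f \<circ> g) \<circ> inv m"
  using assms by (simp add: fun_eq_iff bij_is_inj)

lemma conj_funpow:
  assumes "bij m"
  shows "(m \<circ> f \<circ> inv m) ^^ k = m \<circ> f ^^ k \<circ> inv m"
proof (induction k)
  case 0
  show ?case using assms by (simp add: fun_eq_iff bij_is_surj surj_f_inv_f)
next
  case (Suc k)
  then show ?case by (simp only: funpow.simps conj_comp[OF assms])
qed

lemma conj_inv:
  assumes "bij m" "bij f"
  shows "inv (m \<circ> f \<circ> inv m) = m \<circ> inv f \<circ> inv m"
  using assms by (simp add: o_inv_distrib bij_comp bij_imp_bij_inv inv_inv_eq o_assoc)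

section \<open>Commutators with controlled supports\<close>

lemma commutator_conj:
  assumes "bij m" "bij f" "bij g"
  shows "commutator (m \<circ> f \<circ> inv m) (m \<circ> g \<circ> inv m) = m \<circ> commutator f g \<circ> inv m"
  using assms by (simp add: commutator_def conj_inv conj_comp)

lemma commutator_self: "bij f \<Longrightarrow> commutator f f = id"
  by (simp add: commutator_def fun_eq_iff bij_is_surj surj_f_inv_f bij_is_inj)

text \<open>For \<open>i\<close> in \<open>I\<close>, both \<open>inv g i\<close> and
  \<open>g i\<close> lie outside \<open>I\<close> and are moved by \<open>g\<close>, so
  \<open>f\<close> fixes them; the same holds with \<open>f\<close> and \<open>g\<close> exchanged.
  Substitution then gives the cycle from \<open>I\<close> to \<open>f I\<close> to
  \<open>g I\<close> and back.\<close>

lemma commutator_three_cycle: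
  assumes "bij f" "bij g" and meet: "\<And>t. t \<notin> I \<Longrightarrow> f t = t \<or> g t = t"
    and "f ` I \<inter> I = {}" "g ` I \<inter> I = {}"
  shows "i \<in> I \<Longrightarrow> commutator f g i = f i"
    and "i \<in> I \<Longrightarrow> commutator f g (f i) = g i"
    and "i \<in> I \<Longrightarrow> commutator f g (g i) = i"
    and "t \<notin> I \<Longrightarrow> t \<notin> f ` I \<Longrightarrow> t \<notin> g ` I \<Longrightarrow> commutator f g t = t"
proof -
  note inj = bij_is_inj[OF assms(1)] bij_is_inj[OF assms(2)]
  note [simp] = inv_f_f[OF inj(1)] inv_f_f[OF inj(2)]
    surj_f_inv_f[OF bij_is_surj[OF assms(1)]] surj_f_inv_f[OF bij_is_surj[OF assms(2)]]
    inj_eq[OF inj(1)] inj_eq[OF inj(2)]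
  have inv_fix: "f s = s \<Longrightarrow> inv f s = s" "g s = s \<Longrightarrow> inv g s = s" for s
    using inv_f_f[OF inj(1), of s] inv_f_f[OF inj(2), of s] by simp_all
  have off: "f i \<notin> I" "g i \<notin> I" if "i \<in> I" for i
    using that assms(4,5) by auto
  show "commutator f g i = f i" if "i \<in> I"
  proof -
    obtain s where s: "i = g s" using bij_is_surj[OF assms(2)] by blast
    have "s \<notin> I" using off(2) s that by blast
    then have "f s = s" using meet[of s] s that by auto
    then show ?thesis using s by (simp add: commutator_def inv_fix)
  qed
  show "commutator f g (f i) = g i" if "i \<in> I"
  proof -
    have "g (f i) = f i" "f (g i) = g i"
      using meet[of "f i"] meet[of "g i"] off[OF that] that by force+
    then show ?thesis by (simp add: commutator_def inv_fix)
  qed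
  show "commutator f g (g i) = i" if "i \<in> I"
  proof -
    obtain s where s: "i = f s" using bij_is_surj[OF assms(1)] by blast
    have "s \<notin> I" using off(1) s that by blast
    then have "g s = s" using meet[of s] s that by auto
    then show ?thesis using s by (simp add: commutator_def)
  qed
  show "commutator f g t = t" if t: "t \<notin> I" "t \<notin> f ` I" "t \<notin> g ` I"
  proof (cases "g t = t")
    case True
    obtain s where s: "t = f s" using bij_is_surj[OF assms(1)] by blast
    then have "s \<notin> I" using t by blast
    then have "f s = s \<or> g s = s" by (rule meet)
    then show ?thesis using s True by (auto simp: commutator_def inv_fix)
  next
    case False
    then have ft: "f t = t" using meet t by blast
    obtain s where s: "t = g s" using bij_is_surj[OF assms(2)] by blast
    then have "s \<notin> I" using t by blast
    then have "f s = s" using meet[of s] s False by auto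
    then show ?thesis using s ft by (simp add: commutator_def inv_fix)
  qed
qed

text \<open>\<open>\<phi>\<close> and \<open>\<psi>\<close> preserve \<open>Q\<close> and its
  complement, because \<open>f\<close> and \<open>g\<close> do. On \<open>Q\<close> they agree with
  \<open>f\<close> and \<open>g\<close>; off \<open>Q\<close> their supports are disjoint, so they
  commute there, and both commutators are trivial.\<close>

lemma commutator_restrict:
  assumes bij: "bij \<phi>" "bij \<psi>" "bij f" "bij g"
    and supp: "supported_in Q f" "supported_in Q g"
    and eq: "\<And>t. t \<in> Q \<Longrightarrow> \<phi> t = f t" "\<And>t. t \<in> Q \<Longrightarrow> \<psi> t = g t"
    and off: "\<And>t. t \<notin> Q \<Longrightarrow> \<phi> t = t \<or> \<psi> t = t"
  shows "commutator \<phi> \<psi> = commutator f g"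
proof
  fix t
  have inv_simps [simp]: "inv h (h s) = s" "h (inv h s) = s" if "bij h" for h :: "'a \<Rightarrow> 'a" and s
    using that by (simp_all add: bij_is_inj bij_is_surj surj_f_inv_f)
  have inQ: "h s \<in> Q" "inv h s \<in> Q" if "bij h" "supported_in Q h" "s \<in> Q" for h s
    using supported_in_image[OF that(2,1)] supported_in_image[OF supported_in_inv[OF that(2,1)]]
      that(1,3) bij_imp_bij_inv by blast+
  have inv_eq: "inv \<phi> s = inv f s" "inv \<psi> s = inv g s" if "s \<in> Q" for s
    using eq(1)[of "inv f s"] eq(2)[of "inv g s"] inQ(2) bij supp that
    by (metis inv_simps)+
  have offQ: "\<phi> s \<notin> Q" "inv \<phi> s \<notin> Q" "\<psi> s \<notin> Q" "inv \<psi> s \<notin> Q" if "s \<notin> Q" for s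
    using that inQ bij supp eq inv_eq by (metis inv_simps)+
  show "commutator \<phi> \<psi> t = commutator f g t"
  proof (cases "t \<in> Q")
    case True
    then show ?thesis
      using inQ bij supp by (simp add: commutator_def eq inv_eq)
  next
    case False
    have "h t = t" "inv h t = t" if "h \<in> {f, g}" for h
      using that False supp bij supported_in_fix supported_in_inv by (metis insertE singletonD)+
    from this[of f] this[of g] have "commutator f g t = t"
      by (simp add: commutator_def)
    moreover have "commutator \<phi> \<psi> t = t"
    proof (cases "\<psi> t = t")
      case True
      then have "inv \<psi> t = t" using bij(2) by (metis inv_simps(1))
      \<comment> \<open>Either \<open>\<psi>\<close> fixes \<open>inv \<phi> t\<close>, or
        \<open>\<phi>\<close> does, and then this point is \<open>t\<close> itself.\<close>
      moreover have "\<psi> (inv \<phi> t) = inv \<phi> t"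
        using off[OF offQ(2)[OF False]] True bij(1) by (metis inv_simps)
      ultimately show ?thesis using bij by (simp add: commutator_def)
    next
      case nfix: False
      then have "\<phi> t = t" using off False by blast
      moreover have "\<phi> (inv \<psi> t) = inv \<psi> t"
        using off[OF offQ(4)[OF False]] nfix bij(2) by (metis inv_simps)
      then have "inv \<phi> (inv \<psi> t) = inv \<psi> t" using bij(1) by (metis inv_simps(1))
      ultimately show ?thesis using bij by (simp add: commutator_def)
    qed
    ultimately show ?thesis by simp
  qed
qed

section \<open>The Sidon property of 0 and the powers of 3\<close>

lemma three_power_sidon:
  fixes i j k l :: nat
  assumes "(3::nat) ^ l + 3 ^ k = 3 ^ j + 3 ^ i" "i \<noteq> k"
  shows "l = i"
proof -
  \<comment> \<open>Two powers with exponents at most \<open>m\<close> add up to at most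
    \<open>2 * 3 ^ m\<close>, which is less than \<open>3 ^ Suc m\<close>. By symmetry both sides
    have the same largest exponent, and these two powers cancel.\<close>
  have bound: "max l k \<le> max j i"
    if "(3::nat) ^ l + 3 ^ k = 3 ^ j + 3 ^ i" for l k j i :: nat
  proof (rule ccontr)
    assume "\<not> ?thesis"
    then have "Suc (max j i) \<le> max l k" by auto
    then have "(3::nat) ^ Suc (max j i) \<le> 3 ^ max l k" by (rule power_increasing) auto
    also have "\<dots> \<le> 3 ^ l + 3 ^ k" by (auto simp: max_def)
    also have "\<dots> = 3 ^ j + 3 ^ i" by (fact that)
    also have "\<dots> \<le> 2 * 3 ^ max j i"
      using add_mono[OF power_increasing[of j "max j i" "3::nat"] power_increasing[of i "max j i" "3::nat"]]
      by simp
    finally show False by simp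
  qed
  have "max l k = max j i"
    using bound[OF assms(1)] bound[OF assms(1)[symmetric]] by (rule antisym)
  then consider "l = j" | "l = i" | "k = j" | "k = i" by (metis max_def)
  then show ?thesis
  proof cases
    case 1 then show ?thesis using assms by simp
  next
    case 3 then show ?thesis using assms by simp
  qed (use assms in auto)
qed

text \<open>Powers of 3 are odd, so parity excludes that exactly one of \<open>d\<close>,
  \<open>d'\<close> is 0. Powers of 2 would not do: 0 + 2 = 1 + 1.\<close>

lemma sidon_zero_three_powers:
  fixes d d' :: nat
  assumes "d + 3 ^ k = d' + 3 ^ i" "i \<noteq> k"
    and "d = 0 \<or> (\<exists>l. d = 3 ^ l)" "d' = 0 \<or> (\<exists>l. d' = 3 ^ l)"
  shows "d = 3 ^ i"
proof -
  have odd: "odd ((3::nat) ^ m)" for m by simp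
  have False if "d = 0" "d' = 3 ^ m" for m
    using that assms(1) odd[of k] odd[of m] odd[of i] by (metis add_0 even_add)
  moreover have False if "d' = 0" "d = 3 ^ m" for m
    using that assms(1) odd[of k] odd[of m] odd[of i] by (metis add_0 even_add)
  moreover have "\<not> (d = 0 \<and> d' = 0)"
  proof
    assume "d = 0 \<and> d' = 0"
    then have "(3::nat) ^ k = 3 ^ i" using assms(1) by simp
    then show False using assms(2) power_inject_exp[of "3::nat" k i] by simp
  qed
  ultimately obtain l m where "d = 3 ^ l" "d' = 3 ^ m" using assms(3,4) by metis
  then show ?thesis using three_power_sidon assms(1,2) by metis
qed

section \<open>Even permutations of translated pieces\<close>

text \<open>All transpositions pass through 0 because the available 3-cycles pass through piece 0: a
  product of two distinct letters is such a 3-cycle.\<close>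

primrec star_word :: "nat list \<Rightarrow> nat \<Rightarrow> nat" where
  "star_word [] = id"
| "star_word (j # js) = Transposition.transpose 0 j \<circ> star_word js"

lemma star_word_append: "star_word (js @ ks) = star_word js \<circ> star_word ks"
  by (induction js) (simp_all add: comp_assoc)

text \<open>Away from 0, the transposition (a b) is the product (0 a)(0 b)(0 a).\<close>

lemma permutes_star_word:
  fixes N :: nat
  assumes "\<tau> permutes {..<N}"
  shows "\<exists>js. 0 \<notin> set js \<and> \<tau> = star_word js"
  using assms finite_lessThan
proof (induction rule: permutes_induct)
  case id
  show ?case by (intro exI[of _ "[]"]) simp
next
  case (swap a b p)
  then obtain js where js: "0 \<notin> set js" "p = star_word js"
    by blast
  have "\<exists>ks. 0 \<notin> set ks \<and> Transposition.transpose a b = star_word ks"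
  proof -
    consider "a = 0" | "b = 0" | "a \<noteq> 0" "b \<noteq> 0" by blast
    then show ?thesis
    proof cases
      case 1
      then show ?thesis using swap by (intro exI[of _ "[b]"]) (simp add: comp_def id_def)
    next
      case 2
      then show ?thesis using swap
        by (intro exI[of _ "[a]"]) (simp add: transpose_commute[of a 0])
    next
      case 3
      then show ?thesis using swap
        by (intro exI[of _ "[a, b, a]"]) (auto simp: fun_eq_iff Transposition.transpose_def)
    qed
  qed
  then obtain ks where ks: "0 \<notin> set ks" "Transposition.transpose a b = star_word ks"
    by blast
  then show ?case using ks js by (intro exI[of _ "ks @ js"]) (simp add: star_word_append)
qed

text \<open>The identity from \<open>N\<close> on turns a rotation of the first \<open>N\<close>
  pieces into an index map on the whole infinite family.\<close>

definition rotate_index :: "nat \<Rightarrow> nat \<Rightarrow> nat \<Rightarrow> nat" where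
  "rotate_index N d j = (if j < N then (j + d) mod N else j)"

lemma rotate_index_add:
  "0 < N \<Longrightarrow> rotate_index N c (rotate_index N d j) = rotate_index N (d + c) j"
  by (simp add: rotate_index_def mod_add_left_eq add.assoc)

lemma rotate_index_permutes: "0 < N \<Longrightarrow> rotate_index N d permutes {..<N}"
proof (rule bij_imp_permutes)
  assume "0 < N"
  \<comment> \<open>\<open>N * d - d\<close> completes \<open>d\<close> to a multiple of
    \<open>N\<close>; the truncated subtraction is exact since \<open>N\<close> is positive.\<close>
  have "inj_on (rotate_index N d) {..<N}"
  proof (rule inj_on_inverseI[where g = "rotate_index N (N * d - d)"])
    fix j assume "j \<in> {..<N}"
    then show "rotate_index N (N * d - d) (rotate_index N d j) = j"
      using \<open>0 < N\<close> by (simp add: rotate_index_add) (simp add: rotate_index_def)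
  qed
  moreover have "rotate_index N d ` {..<N} \<subseteq> {..<N}"
    using \<open>0 < N\<close> by (auto simp: rotate_index_def)
  ultimately show "bij_betw (rotate_index N d) {..<N} {..<N}"
    by (simp add: bij_betw_def endo_inj_surj)
qed (simp add: rotate_index_def)

text \<open>Abstracts from the topology: \<open>K\<close> stands for the Boolean algebra of clopen
  sets of a Cantor space \<open>\<Omega>\<close>, with points separated and none isolated.\<close>

locale clopen_action =
  fixes \<Omega> :: "'a set" and K :: "'a set set" and G :: "('a \<Rightarrow> 'a) set"
  assumes K_subset: "A \<in> K \<Longrightarrow> A \<subseteq> \<Omega>"
    and top_in_K: "\<Omega> \<in> K"
    and K_diff: "A \<in> K \<Longrightarrow> B \<in> K \<Longrightarrow> A - B \<in> K"
    and K_separates: "x \<in> \<Omega> \<Longrightarrow> y \<in> \<Omega> \<Longrightarrow> x \<noteq> y \<Longrightarrow> \<exists>U\<in>K. x \<in> U \<and> y \<notin> U"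
    and K_perfect: "A \<in> K \<Longrightarrow> x \<in> A \<Longrightarrow> \<exists>y\<in>A. y \<noteq> x"
    and G_group: "fun_group G"
    and G_bij: "f \<in> G \<Longrightarrow> bij f"
    and G_supported: "f \<in> G \<Longrightarrow> supported_in \<Omega> f"
    and G_K: "f \<in> G \<Longrightarrow> A \<in> K \<Longrightarrow> f ` A \<in> K"
    and G_vigorous: "A \<in> K \<Longrightarrow> B \<in> K \<Longrightarrow> C \<in> K \<Longrightarrow> B \<noteq> {} \<Longrightarrow> B \<subset> A \<Longrightarrow> C \<noteq> {} \<Longrightarrow> C \<subset> A
      \<Longrightarrow> \<exists>f\<in>G. supported_in A f \<and> f ` B \<subseteq> C"
begin

lemma G_id: "id \<in> G" and G_inv: "f \<in> G \<Longrightarrow> inv f \<in> G"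
  and G_comp: "f \<in> G \<Longrightarrow> g \<in> G \<Longrightarrow> f \<circ> g \<in> G"
  using G_group unfolding fun_group_def by blast+

lemma G_commutator: "f \<in> G \<Longrightarrow> g \<in> G \<Longrightarrow> commutator f g \<in> G"
  by (rule fun_group_commutator[OF G_group])

lemma G_inv_f [simp]: "f \<in> G \<Longrightarrow> inv f (f t) = t"
  and G_f_inv [simp]: "f \<in> G \<Longrightarrow> f (inv f t) = t"
  and G_eq [simp]: "f \<in> G \<Longrightarrow> f s = f t \<longleftrightarrow> s = t"
  using G_bij by (auto simp: bij_is_inj bij_is_surj surj_f_inv_f inj_eq)

lemma K_inter: "A \<in> K \<Longrightarrow> B \<in> K \<Longrightarrow> A \<inter> B \<in> K"
  using K_diff[of A "A - B"] K_diff[of A B] by (simp add: Diff_Diff_Int)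

lemma K_union:
  assumes "A \<in> K" "B \<in> K" shows "A \<union> B \<in> K"
proof -
  have "A \<union> B = \<Omega> - ((\<Omega> - A) - B)"
    using K_subset[OF assms(1)] K_subset[OF assms(2)] by blast
  then show ?thesis using assms top_in_K K_diff by metis
qed

lemma K_split:
  assumes "A \<in> K" "A \<noteq> {}"
  shows "\<exists>B\<in>K. B \<noteq> {} \<and> B \<subset> A"
proof -
  obtain x y where "x \<in> A" "y \<in> A" "x \<noteq> y" using assms K_perfect by blast
  moreover from this obtain U where "U \<in> K" "x \<in> U" "y \<notin> U"
    using K_separates K_subset[OF assms(1)] by (metis subsetD)
  ultimately show ?thesis using K_inter[OF assms(1)] by (intro bexI[of _ "A \<inter> U"]) auto
qed

text \<open>Repeated splitting gives a strictly decreasing chain; the differences of consecutive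
  terms are disjoint and non-empty.\<close>

lemma K_disjoint_sequence:
  assumes "A \<in> K" "A \<noteq> {}"
  obtains B :: "nat \<Rightarrow> 'a set"
  where "\<And>j. B j \<in> K" "\<And>j. B j \<noteq> {}" "\<And>j. B j \<subseteq> A" "\<And>j k. j \<noteq> k \<Longrightarrow> B j \<inter> B k = {}"
proof -
  have "\<exists>D. \<forall>n. (D n \<in> K \<and> D n \<noteq> {} \<and> D n \<subseteq> A) \<and> D (Suc n) \<subset> D n"
  proof (rule dependent_nat_choice)
    show "\<exists>D. D \<in> K \<and> D \<noteq> {} \<and> D \<subseteq> A" using assms by auto
    fix D :: "'a set" and n :: nat assume D: "D \<in> K \<and> D \<noteq> {} \<and> D \<subseteq> A"
    then obtain B where "B \<in> K" "B \<noteq> {}" "B \<subset> D" using K_split[of D] by auto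
    then show "\<exists>B. (B \<in> K \<and> B \<noteq> {} \<and> B \<subseteq> A) \<and> B \<subset> D" using D by auto
  qed
  then obtain D where "\<forall>n. (D n \<in> K \<and> D n \<noteq> {} \<and> D n \<subseteq> A) \<and> D (Suc n) \<subset> D n" ..
  then have D: "D n \<in> K" "D n \<noteq> {}" "D n \<subseteq> A" "D (Suc n) \<subset> D n" for n
    by (metis (no_types))+
  have dec: "D k \<subseteq> D j" if "j \<le> k" for j k
    using that by (rule lift_Suc_antimono_le[rotated]) (simp only: psubset_imp_subset[OF D(4)])
  have disj: "(D j - D (Suc j)) \<inter> (D k - D (Suc k)) = {}" if "j < k" for j k
    using dec[of "Suc j" k] that by auto
  show thesis
  proof
    show "D j - D (Suc j) \<in> K" for j by (rule K_diff[OF D(1) D(1)])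
    show "D j - D (Suc j) \<noteq> {}" "D j - D (Suc j) \<subseteq> A" for j
      using D(4)[of j] D(3)[of j] by blast+
    show "(D j - D (Suc j)) \<inter> (D k - D (Suc k)) = {}" if "j \<noteq> k" for j k
      using disj[of j k] disj[of k j] that by (cases "j < k") auto
  qed
qed

text \<open>The moved sets of the \<open>x j\<close> meet only in \<open>I\<close>, so commutators of the \<open>x j\<close> permute
  the pieces \<open>x j ` I\<close> in 3-cycles. Piece 0 is \<open>I\<close> itself.\<close>
definition matched :: "'a set \<Rightarrow> (nat \<Rightarrow> 'a \<Rightarrow> 'a) \<Rightarrow> bool" where
  "matched I x \<longleftrightarrow> x 0 = id \<and> (\<forall>j. x j \<in> G) \<and> (\<forall>j k. j \<noteq> k \<longrightarrow> x j ` I \<inter> x k ` I = {}) \<and>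
    (\<forall>j k t. 0 < j \<longrightarrow> 0 < k \<longrightarrow> j \<noteq> k \<longrightarrow> t \<notin> I \<longrightarrow> x j t = t \<or> x k t = t)"

lemma matchedD:
  assumes "matched I x"
  shows "x 0 = id" "x j \<in> G" "j \<noteq> k \<Longrightarrow> x j ` I \<inter> x k ` I = {}"
    and "0 < j \<Longrightarrow> 0 < k \<Longrightarrow> j \<noteq> k \<Longrightarrow> t \<notin> I \<Longrightarrow> x j t = t \<or> x k t = t"
  using assms by (simp_all add: matched_def)

text \<open>With disjoint sets \<open>B j\<close> inside \<open>A\<close>, vigor on
  \<open>I \<union> B j\<close> supplies an element that moves \<open>I\<close> into
  \<open>B j\<close>. The supports of two such elements meet only in \<open>I\<close>.\<close>

lemma matched_exists:
  assumes "I \<in> K" "A \<in> K" "I \<noteq> {}" "A \<noteq> {}" "I \<inter> A = {}"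
  obtains x where "matched I x" "\<And>j. 0 < j \<Longrightarrow> x j ` I \<subseteq> A" "\<And>j. supported_in (I \<union> A) (x j)"
proof -
  obtain B where B: "\<And>j :: nat. B j \<in> K" "\<And>j. B j \<noteq> {}" "\<And>j. B j \<subseteq> A"
    "\<And>j k. j \<noteq> k \<Longrightarrow> B j \<inter> B k = {}"
    using K_disjoint_sequence assms by metis
  have "\<exists>f\<in>G. supported_in (I \<union> B j) f \<and> f ` I \<subseteq> B j" for j
    by (rule G_vigorous) (use B[of j] assms K_union in auto)
  then have "\<forall>j. \<exists>f. f \<in> G \<and> supported_in (I \<union> B j) f \<and> f ` I \<subseteq> B j" by blast
  from choice[OF this] obtain y
    where y: "\<And>j. y j \<in> G" "\<And>j. supported_in (I \<union> B j) (y j)" "\<And>j. y j ` I \<subseteq> B j"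
    by auto
  define x where "x j = (if j = 0 then id else y j)" for j
  show thesis
  proof
    show im: "x j ` I \<subseteq> A" if "0 < j" for j
      using that y(3)[of j] B(3)[of j] by (auto simp: x_def)
    show "supported_in (I \<union> A) (x j)" for j
      using supported_in_mono[OF y(2)[of j], of "I \<union> A"] B(3)[of j]
      by (auto simp: x_def supported_in_def)
    show "matched I x"
      unfolding matched_def
    proof (intro conjI allI impI)
      show "x 0 = id" "x j \<in> G" for j using y G_id by (simp_all add: x_def)
      show "x j ` I \<inter> x k ` I = {}" if "j \<noteq> k" for j k
      proof (cases "j = 0 \<or> k = 0")
        case True
        then show ?thesis using that im[of j] im[of k] assms(5) by (auto simp: x_def)
      next
        case False
        then show ?thesis using y(3)[of j] y(3)[of k] B(4)[OF that] by (auto simp: x_def)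
      qed
      show "x j t = t \<or> x k t = t" if "0 < j" "0 < k" "j \<noteq> k" "t \<notin> I" for j k t
        using that B(4)[OF that(3)] y(2)[of j] y(2)[of k] by (auto simp: x_def supported_in_def)
    qed
  qed
qed

text \<open>The maps \<open>x j\<close> identify \<open>I\<close> with the pieces. Respecting these
  identifications determines \<open>f\<close> from \<open>\<tau>\<close>, so relations between index
  maps pass to \<open>G\<close>.\<close>

definition realizes :: "'a set \<Rightarrow> (nat \<Rightarrow> 'a \<Rightarrow> 'a) \<Rightarrow> (nat \<Rightarrow> nat) \<Rightarrow> ('a \<Rightarrow> 'a) \<Rightarrow> bool" where
  "realizes I x \<tau> f \<longleftrightarrow> (\<forall>j. \<forall>i\<in>I. f (x j i) = x (\<tau> j) i) \<and> supported_in (\<Union>j. x j ` I) f"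

lemma realizes_comp: "realizes I x \<tau> f \<Longrightarrow> realizes I x \<rho> g \<Longrightarrow> realizes I x (\<tau> \<circ> \<rho>) (f \<circ> g)"
  by (simp add: realizes_def supported_in_comp)

lemma realizes_id: "realizes I x id id"
  by (simp add: realizes_def supported_in_def)

lemma matched_commutator:
  assumes "matched I x" "0 < a" "0 < b" "a \<noteq> b"
  shows "i \<in> I \<Longrightarrow> commutator (x a) (x b) i = x a i"
    and "i \<in> I \<Longrightarrow> commutator (x a) (x b) (x a i) = x b i"
    and "i \<in> I \<Longrightarrow> commutator (x a) (x b) (x b i) = i"
    and "t \<notin> I \<Longrightarrow> t \<notin> x a ` I \<Longrightarrow> t \<notin> x b ` I \<Longrightarrow> commutator (x a) (x b) t = t"
proof -
  have x0: "x 0 ` I = I" using assms(1) by (simp add: matched_def)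
  have disj: "x j ` I \<inter> I = {}" if "0 < j" for j
    using matchedD(3)[OF assms(1), of j 0] that x0 by simp
  have "bij (x a)" "bij (x b)" "\<And>t. t \<notin> I \<Longrightarrow> x a t = t \<or> x b t = t"
    using G_bij matchedD(2,4)[OF assms(1)] assms(2-4) by simp_all
  note * = commutator_three_cycle[OF this disj[OF assms(2)] disj[OF assms(3)]]
  show "i \<in> I \<Longrightarrow> commutator (x a) (x b) i = x a i"
    "i \<in> I \<Longrightarrow> commutator (x a) (x b) (x a i) = x b i"
    "i \<in> I \<Longrightarrow> commutator (x a) (x b) (x b i) = i"
    "t \<notin> I \<Longrightarrow> t \<notin> x a ` I \<Longrightarrow> t \<notin> x b ` I \<Longrightarrow> commutator (x a) (x b) t = t"
    using * by simp_all
qed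

text \<open>Applied from right to left, (0 a)(0 b) sends 0 to b, b to a and a to 0; hence
  \<open>x b\<close> is the first entry of the commutator.\<close>

lemma realizes_star_pair:
  assumes "matched I x" "0 < a" "0 < b"
  shows "\<exists>f\<in>G. realizes I x (Transposition.transpose 0 a \<circ> Transposition.transpose 0 b) f"
proof (cases "a = b")
  case True
  then show ?thesis using realizes_id G_id by (metis transpose_comp_involutory)
next
  case False
  then have "b \<noteq> a" by simp
  note comm = matched_commutator[OF assms(1,3,2) this]
  note x0 = matchedD(1)[OF assms(1)] and G = matchedD(2)[OF assms(1)]
    and disj = matchedD(3)[OF assms(1)]
  have "realizes I x (Transposition.transpose 0 a \<circ> Transposition.transpose 0 b) (commutator (x b) (x a))"
    unfolding realizes_def
  proof (intro conjI allI ballI)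
    fix j i assume i: "i \<in> I"
    consider "j = 0" | "j = a" | "j = b" | "j \<noteq> 0" "j \<noteq> a" "j \<noteq> b" by blast
    then show "commutator (x b) (x a) (x j i) = x ((Transposition.transpose 0 a \<circ> Transposition.transpose 0 b) j) i"
    proof cases
      case 4
      then have "x j i \<notin> I" "x j i \<notin> x a ` I" "x j i \<notin> x b ` I"
        using disj[of j 0] disj[of j a] disj[of j b] i x0 by auto
      then show ?thesis using 4 comm(4) by simp
    qed (use assms False comm(1-3)[OF i] x0 in \<open>auto simp: Transposition.transpose_def\<close>)
  next
    show "supported_in (\<Union>j. x j ` I) (commutator (x b) (x a))"
      unfolding supported_in_def
    proof (intro allI impI)
      fix t assume "t \<notin> (\<Union>j. x j ` I)"
      then have "t \<notin> x 0 ` I" "t \<notin> x a ` I" "t \<notin> x b ` I" by blast+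
      then show "commutator (x b) (x a) t = t" using comm(4) x0 by simp
    qed
  qed
  then show ?thesis using G G_commutator by blast
qed

lemma realizes_even_stars:
  assumes "matched I x" "0 \<notin> set js" "even (length js)"
  shows "\<exists>f\<in>G. realizes I x (star_word js) f"
  using assms(2,3)
proof (induction js rule: induct_list012)
  case 1
  then show ?case using realizes_id G_id by (metis star_word.simps(1))
next
  case (3 a b js)
  then obtain f where f: "f \<in> G" "realizes I x (star_word js) f" by auto
  obtain g where "g \<in> G" "realizes I x (Transposition.transpose 0 a \<circ> Transposition.transpose 0 b) g"
    using realizes_star_pair[OF assms(1), of a b] 3(3) by auto
  then have "g \<circ> f \<in> G" "realizes I x (star_word (a # b # js)) (g \<circ> f)"
    using realizes_comp[of I x _ g] f G_comp by (simp_all only: star_word.simps o_assoc)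
  then show ?case by blast
qed auto

text \<open>Only even permutations of the pieces are available; the square of a permutation is even.\<close>
lemma realizes_rotation:
  assumes "matched I x" "0 < N"
  shows "\<exists>f\<in>G. realizes I x (rotate_index N (2 * d)) f"
proof -
  obtain js where js: "0 \<notin> set js" "rotate_index N d = star_word js"
    using permutes_star_word[OF rotate_index_permutes] assms(2) by metis
  have "star_word (js @ js) = rotate_index N d \<circ> rotate_index N d"
    using js(2) by (simp add: star_word_append)
  also have "\<dots> = rotate_index N (2 * d)"
    using assms(2) by (simp add: fun_eq_iff rotate_index_add mult_2)
  finally show ?thesis
    using realizes_even_stars[OF assms(1), of "js @ js"] js(1) by simp
qed

text \<open>Rotating \<open>2 * n\<close> pieces by two places has order \<open>n\<close> and is a
  square, hence even. The number of pieces is doubled because the square of an n-cycle has order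
  \<open>n\<close> only for odd \<open>n\<close>.\<close>

lemma exists_order:
  assumes "I \<in> K" "I \<noteq> {}" "I \<noteq> \<Omega>" "0 < n"
  shows "\<exists>f\<in>G. \<forall>k. f ^^ k = id \<longleftrightarrow> n dvd k"
proof -
  have "\<Omega> - I \<in> K" "\<Omega> - I \<noteq> {}" using assms K_diff top_in_K K_subset by blast+
  then obtain x where x: "matched I x"
    using matched_exists[of I "\<Omega> - I"] assms by (metis Diff_disjoint)
  obtain f where f: "f \<in> G" "realizes I x (rotate_index (2 * n) (2 * 1)) f"
    using realizes_rotation[OF x, of "2 * n" 1] assms by auto
  have pow: "realizes I x (rotate_index (2 * n) (2 * k)) (f ^^ k)" for k
  proof (induction k)
    case 0
    have "rotate_index (2 * n) 0 = id" by (auto simp: rotate_index_def)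
    then show ?case using realizes_id by (metis funpow.simps(1) mult_0_right)
  next
    case (Suc k)
    have "rotate_index (2 * n) (2 * 1) \<circ> rotate_index (2 * n) (2 * k) = rotate_index (2 * n) (2 * Suc k)"
      using assms by (simp add: fun_eq_iff rotate_index_add)
    then show ?case using realizes_comp[OF f(2) Suc] by (simp only: funpow.simps)
  qed
  obtain i where i: "i \<in> I" using assms by blast
  have "f ^^ k = id \<longleftrightarrow> n dvd k" for k
  proof
    assume "f ^^ k = id"
    then have "x 0 i = x (rotate_index (2 * n) (2 * k) 0) i"
      using pow[of k] i by (metis realizes_def id_apply)
    then have "x 0 ` I \<inter> x (rotate_index (2 * n) (2 * k) 0) ` I \<noteq> {}" using i by blast
    then have "rotate_index (2 * n) (2 * k) 0 = 0" using x unfolding matched_def by metis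
    then show "n dvd k" using assms by (simp add: rotate_index_def mod_eq_0_iff_dvd)
  next
    assume "n dvd k"
    then obtain m where m: "2 * k = 2 * n * m" by (auto elim: dvdE)
    have "rotate_index (2 * n) (2 * k) = id"
      unfolding m by (auto simp del: mult.assoc mult_ac simp: rotate_index_def fun_eq_iff)
    then have r: "realizes I x id (f ^^ k)" using pow[of k] by (simp only:)
    show "f ^^ k = id"
    proof
      fix t show "(f ^^ k) t = id t"
      proof (cases "t \<in> (\<Union>j. x j ` I)")
        case False
        then show ?thesis using r by (simp add: realizes_def supported_in_def)
      next
        case True
        then show ?thesis using r by (auto simp: realizes_def)
      qed
    qed
  qed
  then show ?thesis using f(1) by blast
qed

section \<open>Commutators of elements of order 3\<close>

lemma fun_group_supported: "fun_group {f \<in> G. supported_in A f}"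
  unfolding fun_group_def
  using G_group G_bij supported_in_inv supported_in_comp
  by (auto simp: fun_group_def supported_in_def)

text \<open>The exponent 3 on the entries is what later makes \<open>\<phi>\<close>, and through it
  \<open>\<sigma>\<close>, a torsion element.\<close>

definition torsion_commutators :: "'a set \<Rightarrow> ('a \<Rightarrow> 'a) set" where
  "torsion_commutators A = {commutator f g | f g.
    f \<in> G \<and> g \<in> G \<and> f ^^ 3 = id \<and> g ^^ 3 = id \<and> supported_in A f \<and> supported_in A g}"

lemma torsion_commutatorsI:
  assumes "f \<in> G" "g \<in> G" "f ^^ 3 = id" "g ^^ 3 = id" "supported_in A f" "supported_in A g"
  shows "commutator f g \<in> torsion_commutators A"
  using assms unfolding torsion_commutators_def by blast

lemma torsion_commutators_supported:
  "torsion_commutators A \<subseteq> {f \<in> G. supported_in A f}"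
proof
  fix c assume "c \<in> torsion_commutators A"
  then obtain f g where "c = commutator f g" "f \<in> {f \<in> G. supported_in A f}" "g \<in> {f \<in> G. supported_in A f}"
    unfolding torsion_commutators_def by blast
  then show "c \<in> {f \<in> G. supported_in A f}"
    using fun_group_commutator[OF fun_group_supported] by blast
qed

lemma gen_torsion_commutators_supported:
  assumes "f \<in> gen (torsion_commutators A)" shows "f \<in> G" "supported_in A f"
  using gen_least[OF torsion_commutators_supported fun_group_supported] assms by blast+

lemma torsion_commutators_mono:
  assumes "A \<subseteq> B" shows "torsion_commutators A \<subseteq> torsion_commutators B"
  using supported_in_mono[OF _ assms] unfolding torsion_commutators_def by blast

lemma torsion_commutators_conj:
  assumes "c \<in> torsion_commutators A" "m \<in> G" "m ` A \<subseteq> B"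
  shows "m \<circ> c \<circ> inv m \<in> torsion_commutators B"
proof -
  obtain f g where c: "c = commutator f g" "f \<in> G" "g \<in> G" "f ^^ 3 = id" "g ^^ 3 = id"
    "supported_in A f" "supported_in A g"
    using assms(1) unfolding torsion_commutators_def by blast
  have "(m \<circ> h \<circ> inv m) ^^ 3 = id" if "h ^^ 3 = id" for h
    using assms(2) that by (simp only: conj_funpow[OF G_bij]) (simp add: fun_eq_iff)
  then have "commutator (m \<circ> f \<circ> inv m) (m \<circ> g \<circ> inv m) \<in> torsion_commutators B"
    using c assms supported_in_conj G_bij by (intro torsion_commutatorsI G_comp G_inv) blast+
  then show ?thesis using c assms G_bij commutator_conj by metis
qed

lemma matched_commutator_cube:
  assumes "matched I x" "0 < a" "0 < b" "a \<noteq> b"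
  shows "commutator (x a) (x b) ^^ 3 = id"
proof
  fix t
  note comm = matched_commutator[OF assms]
  show "(commutator (x a) (x b) ^^ 3) t = id t"
  proof (cases "t \<in> I \<union> x a ` I \<union> x b ` I")
    case True
    then show ?thesis using comm(1-3) by (auto simp: numeral_3_eq_3)
  next
    case False
    then show ?thesis using comm(4) by (simp add: numeral_3_eq_3)
  qed
qed

text \<open>A commutator of commutators: \<open>[x 1, x 3]\<close> and \<open>[x 2, x 4]\<close> are
  3-cycles of pieces, and their supports meet only in \<open>B\<close>. So
  \<open>commutator_three_cycle\<close> applies once more, and the result acts on \<open>B\<close>
  as \<open>x 1\<close>.\<close>

lemma torsion_commutator_moves_off:
  assumes "B \<in> K" "C \<in> K" "B \<noteq> {}" "C \<noteq> {}" "B \<inter> C = {}"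
  shows "\<exists>k\<in>torsion_commutators (B \<union> C). k ` B \<subseteq> C"
proof -
  obtain x where x: "matched B x" "\<And>j. 0 < j \<Longrightarrow> x j ` B \<subseteq> C" "\<And>j. supported_in (B \<union> C) (x j)"
    using matched_exists[OF assms(1-2,3-5)] by blast
  define f where "f = commutator (x 1) (x 3)"
  define g where "g = commutator (x 2) (x 4)"
  note f = matched_commutator[OF x(1), of 1 3, folded f_def, simplified]
    and g = matched_commutator[OF x(1), of 2 4, folded g_def, simplified]
  have fgG: "f \<in> G" "g \<in> G"
    unfolding f_def g_def by (intro G_commutator matchedD(2)[OF x(1)])+
  have cube: "f ^^ 3 = id" "g ^^ 3 = id"
    unfolding f_def g_def by (intro matched_commutator_cube[OF x(1)]; simp)+
  have supp: "supported_in (B \<union> C) f" "supported_in (B \<union> C) g"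
    unfolding supported_in_def using f(4) g(4) x(2)[of 1] x(2)[of 2] x(2)[of 3] x(2)[of 4]
    by fastforce+
  have meet: "f t = t \<or> g t = t" if "t \<notin> B" for t
  proof (rule ccontr)
    assume "\<not> ?thesis"
    then have "t \<in> x 1 ` B \<union> x 3 ` B" "t \<in> x 2 ` B \<union> x 4 ` B"
      using f(4)[of t] g(4)[of t] that by auto
    then show False
      using matchedD(3)[OF x(1), of 1 2] matchedD(3)[OF x(1), of 1 4]
        matchedD(3)[OF x(1), of 3 2] matchedD(3)[OF x(1), of 3 4] by auto
  qed
  have im: "f ` B \<subseteq> C" "g ` B \<subseteq> C"
    using f(1) g(1) x(2)[of 1] x(2)[of 2] by auto
  then have "f ` B \<inter> B = {}" "g ` B \<inter> B = {}" using assms(5) by auto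
  from commutator_three_cycle(1)[OF G_bij[OF fgG(1)] G_bij[OF fgG(2)] meet this]
  have "commutator f g ` B \<subseteq> C" using im by auto
  then show ?thesis using torsion_commutatorsI[OF fgG cube supp] by blast
qed

text \<open>\<open>torsion_commutator_moves_off\<close> asks for disjoint source and target. If
  \<open>C\<close> is not contained in \<open>B\<close>, the target is \<open>C - B\<close>;
  otherwise \<open>B\<close> is first parked in \<open>Q - B\<close>, which is disjoint from
  \<open>C\<close>.\<close>

lemma torsion_commutators_vigorous:
  assumes "Q \<in> K" "B \<in> K" "C \<in> K" "B \<subset> Q" "C \<subseteq> Q" "C \<noteq> {}"
  shows "\<exists>k\<in>gen (torsion_commutators Q). k ` B \<subseteq> C"
proof -
  note grp = fun_group_gen[of "torsion_commutators Q"]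
  have step: "\<exists>k\<in>gen (torsion_commutators Q). k ` B \<subseteq> C"
    if BC: "B \<in> K" "C \<in> K" "B \<noteq> {}" "C \<noteq> {}" "B \<inter> C = {}" "B \<subseteq> Q" "C \<subseteq> Q" for B C
  proof -
    obtain k where "k \<in> torsion_commutators (B \<union> C)" "k ` B \<subseteq> C"
      using torsion_commutator_moves_off[OF BC(1-5)] by blast
    moreover have "torsion_commutators (B \<union> C) \<subseteq> gen (torsion_commutators Q)"
      using torsion_commutators_mono[of "B \<union> C" Q] gen_incl BC(6,7) by blast
    ultimately show ?thesis by blast
  qed
  consider "B = {}" | "B \<noteq> {}" "C - B \<noteq> {}" | "B \<noteq> {}" "C \<subseteq> B" by blast
  then show ?thesis
  proof cases
    case 1
    then show ?thesis using grp unfolding fun_group_def by blast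
  next
    case 2
    then obtain k where "k \<in> gen (torsion_commutators Q)" "k ` B \<subseteq> C - B"
      using step[OF assms(2) K_diff[OF assms(3,2)]] assms by blast
    then show ?thesis by blast
  next
    case 3
    obtain k where k: "k \<in> gen (torsion_commutators Q)" "k ` B \<subseteq> Q - B"
      using step[OF assms(2) K_diff[OF assms(1,2)]] assms 3 by blast
    have "k ` B \<in> K" using G_K gen_torsion_commutators_supported(1) k(1) assms(2) by blast
    then obtain k' where k': "k' \<in> gen (torsion_commutators Q)" "k' ` k ` B \<subseteq> C"
      using step[of "k ` B" C] assms 3 k(2) by blast
    then have "k' \<circ> k \<in> gen (torsion_commutators Q)" "(k' \<circ> k) ` B \<subseteq> C"
      using grp k(1) unfolding fun_group_def by (auto simp: image_comp)
    then show ?thesis by blast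
  qed
qed

text \<open>First \<open>B\<close> is pushed into the union of the complements \<open>F\<close> of
  \<open>E\<close> and \<open>R\<close> of \<open>Q\<close>: if \<open>Q\<close> is not inside
  \<open>B\<close>, the part in \<open>Q\<close> is compressed into \<open>F\<close>; otherwise
  \<open>E\<close> is not inside \<open>B\<close>, and the part in \<open>E\<close> is compressed
  into \<open>R\<close>. An element supported in \<open>E\<close> then takes \<open>R\<close> into
  the overlap and fixes \<open>F\<close>, which already lies in \<open>Q\<close>.\<close>

lemma moves_into_overlapping_cover:
  assumes K: "Q \<in> K" "E \<in> K" and proper: "Q \<noteq> \<Omega>" "E \<noteq> \<Omega>" and cover: "Q \<union> E = \<Omega>" "Q \<inter> E \<noteq> {}"
    and H: "fun_group H" "torsion_commutators Q \<subseteq> H" "torsion_commutators E \<subseteq> H"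
    and B: "B \<in> K" "B \<noteq> \<Omega>"
  shows "\<exists>m\<in>G \<inter> H. m ` B \<subseteq> Q"
proof -
  define F where "F = \<Omega> - E"
  define R where "R = \<Omega> - Q"
  have FR: "F \<in> K" "R \<in> K" "F \<subseteq> Q" "R \<subseteq> E" "F \<noteq> {}" "R \<noteq> {}" "R \<noteq> E" "B \<subseteq> \<Omega>"
    using K_diff[OF top_in_K] K proper cover K_subset[of E] K_subset[of Q] K_subset[OF B(1)]
    by (auto simp: F_def R_def)
  have sub: "gen (torsion_commutators Q) \<subseteq> H" "gen (torsion_commutators E) \<subseteq> H"
    using gen_least H by blast+
  have "\<exists>k\<in>G \<inter> H. k ` B \<subseteq> F \<union> R"
  proof (cases "Q \<subseteq> B")
    case False
    then obtain k where k: "k \<in> gen (torsion_commutators Q)" "k ` (B \<inter> Q) \<subseteq> F"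
      using torsion_commutators_vigorous[OF K(1) K_inter[OF B(1) K(1)] FR(1)] FR by blast
    have "k t = t" if "t \<notin> Q" for t
      using gen_torsion_commutators_supported(2)[OF k(1)] that by (rule supported_in_fix)
    then have "k ` B \<subseteq> F \<union> R" using k(2) FR(8) unfolding R_def by fastforce
    then show ?thesis using k(1) sub gen_torsion_commutators_supported(1) by blast
  next
    case True
    then have "B \<inter> E \<noteq> E" using B(2) FR(8) cover(1) by blast
    then obtain k where k: "k \<in> gen (torsion_commutators E)" "k ` (B \<inter> E) \<subseteq> R"
      using torsion_commutators_vigorous[OF K(2) K_inter[OF B(1) K(2)] FR(2)] FR by blast
    have "k t = t" if "t \<notin> E" for t
      using gen_torsion_commutators_supported(2)[OF k(1)] that by (rule supported_in_fix)
    then have "k ` B \<subseteq> F \<union> R" using k(2) FR(8) unfolding F_def by fastforce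
    then show ?thesis using k(1) sub gen_torsion_commutators_supported(1) by blast
  qed
  then obtain k where k: "k \<in> G" "k \<in> H" "k ` B \<subseteq> F \<union> R" by blast
  obtain k' where k': "k' \<in> gen (torsion_commutators E)" "k' ` R \<subseteq> E \<inter> Q"
    using torsion_commutators_vigorous[OF K(2) FR(2) K_inter[OF K(2,1)]] FR cover by blast
  have "k' t = t" if "t \<notin> E" for t
    using gen_torsion_commutators_supported(2)[OF k'(1)] that by (rule supported_in_fix)
  then have "k' t \<in> Q" if "t \<in> F" for t
    using that FR(3) by (metis DiffD2 F_def subsetD)
  then have "k' ` (F \<union> R) \<subseteq> Q" using k'(2) by blast
  moreover have "(k' \<circ> k) ` B \<subseteq> k' ` (F \<union> R)"
    unfolding image_comp[symmetric] by (rule image_mono[OF k(3)])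
  ultimately have "(k' \<circ> k) ` B \<subseteq> Q" by (rule subset_trans[rotated])
  moreover have "k' \<circ> k \<in> G \<inter> H"
    using k k'(1) sub(2) gen_torsion_commutators_supported(1)[OF k'(1)] H(1) G_comp
    unfolding fun_group_def by blast
  ultimately show ?thesis by blast
qed

text \<open>Each factor preserves its own \<open>A i\<close> and fixes the other sets pointwise, so
  the factors do not disturb each other.\<close>

lemma disjoint_product:
  fixes s :: nat
  assumes "\<And>i. i < s \<Longrightarrow> g i \<in> G" "\<And>i. i < s \<Longrightarrow> supported_in (A i) (g i)"
    and "\<And>i j. i < s \<Longrightarrow> j < s \<Longrightarrow> i \<noteq> j \<Longrightarrow> A i \<inter> A j = {}"
  shows "\<exists>\<Phi>\<in>G. (\<forall>i<s. \<forall>t\<in>A i. \<Phi> t = g i t) \<and> supported_in (\<Union>i<s. A i) \<Phi>"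
  using assms
proof (induction s)
  case 0
  show ?case using G_id by (intro bexI[of _ id]) (auto simp: supported_in_def)
next
  case (Suc s)
  have "\<exists>\<Phi>\<in>G. (\<forall>i<s. \<forall>t\<in>A i. \<Phi> t = g i t) \<and> supported_in (\<Union>i<s. A i) \<Phi>"
    by (rule Suc.IH) (use Suc.prems in auto)
  then obtain \<Phi> where \<Phi>: "\<Phi> \<in> G" "\<And>i t. i < s \<Longrightarrow> t \<in> A i \<Longrightarrow> \<Phi> t = g i t"
    "supported_in (\<Union>i<s. A i) \<Phi>" by blast
  have g: "g s \<in> G" "supported_in (A s) (g s)" using Suc.prems by auto
  have "(\<Phi> \<circ> g s) t = g i t" if "i < Suc s" "t \<in> A i" for i t
  proof (cases "i = s")
    case True
    have "g s t \<in> A s"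
      using supported_in_image[OF g(2) G_bij[OF g(1)]] that(2) True by blast
    then have "g s t \<notin> A j" if "j < s" for j using Suc.prems(3)[of s j] that by auto
    then have "g s t \<notin> (\<Union>i<s. A i)" by blast
    then show ?thesis using True supported_in_fix[OF \<Phi>(3)] by simp
  next
    case False
    then have "t \<notin> A s" using that Suc.prems(3)[of i s] by auto
    then show ?thesis using False that \<Phi>(2) supported_in_fix[OF g(2)] by simp
  qed
  moreover have "supported_in (\<Union>i<Suc s. A i) (\<Phi> \<circ> g s)"
  proof (rule supported_in_comp)
    show "supported_in (\<Union>i<Suc s. A i) \<Phi>"
      by (rule supported_in_mono[OF \<Phi>(3)]) (simp add: lessThan_Suc subset_insertI2 Un_upper2)
    show "supported_in (\<Union>i<Suc s. A i) (g s)" by (rule supported_in_mono[OF g(2)]) (simp add: lessThan_Suc)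
  qed
  ultimately show ?case using \<Phi>(1) g(1) G_comp by blast
qed

section \<open>Two generators\<close>

text \<open>\<open>\<pi>\<close> carries \<open>Q\<close> around a cycle of \<open>p\<close> pieces,
  and \<open>\<phi>\<close> acts only on arrival at piece 0, once per round. Seen through
  \<open>w i\<close>, the power \<open>\<sigma> ^^ p\<close> shows the copy of \<open>f i\<close> on
  \<open>Q\<close>.\<close>

lemma two_element_realization:
  fixes f :: "nat \<Rightarrow> 'a \<Rightarrow> 'a" and s :: nat
  assumes Q: "Q \<in> K" "Q \<noteq> {}" "Q \<noteq> \<Omega>"
    and \<zeta>: "\<zeta> \<in> G" "\<zeta> ` (\<Omega> - Q) \<inter> (\<Omega> - Q) = {}"
    and f: "\<And>i. i < s \<Longrightarrow> f i \<in> G" "\<And>i. i < s \<Longrightarrow> f i ^^ 3 = id"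
      "\<And>i. i < s \<Longrightarrow> supported_in Q (f i)"
  shows "\<exists>\<sigma>\<in>G. (\<exists>m>0. \<sigma> ^^ m = id) \<and>
    (\<forall>i<s. \<forall>k<s. commutator (f i) (f k) \<in> gen {\<sigma>, \<zeta>})"
proof -
  define R where "R = \<Omega> - Q"
  \<comment> \<open>Odd, so that a p-cycle is even, and above \<open>2 * 3 ^ s\<close>, so that the
    sums of two indices used below never wrap around.\<close>
  define p :: nat where "p = 2 * 3 ^ s + 1"
  have Q_top: "Q \<subseteq> \<Omega>" by (rule K_subset[OF Q(1)])
  have R: "R \<in> K" "R \<noteq> {}" "Q \<inter> R = {}"
    unfolding R_def using Q Q_top K_diff[OF top_in_K Q(1)] by auto
  have p: "0 < p" "1 < p" by (simp_all add: p_def)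
  have small: "3 ^ l \<le> (3::nat) ^ s" if "l < s" for l
    using that by (intro power_increasing) auto
  have lt_p: "3 ^ l < p" if "l < s" for l
    using small[OF that] unfolding p_def by linarith
  have \<zeta>_top: "\<zeta> t \<in> \<Omega> \<longleftrightarrow> t \<in> \<Omega>" for t
    using supported_in_image[OF G_supported[OF \<zeta>(1)] G_bij[OF \<zeta>(1)]] \<zeta>(1)
    by (metis G_inv_f imageE image_eqI)
  have \<zeta>_R: "\<zeta> t \<in> Q" if "t \<in> R" for t
    using that \<zeta>(2) \<zeta>_top[of t] unfolding R_def by blast
  have \<zeta>_Q: "t \<in> Q" if "\<zeta> t \<in> R" for t
    using that \<zeta>(2) \<zeta>_top[of t] unfolding R_def by blast
  obtain x where x: "matched Q x" "\<And>j. 0 < j \<Longrightarrow> x j ` Q \<subseteq> R"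
    using matched_exists[OF Q(1) R(1) Q(2) R(2,3)] by metis
  note x0 = matchedD(1)[OF x(1)] and xG = matchedD(2)[OF x(1)]
  have x_inj: "j = k" if "x j q = x k q'" "q \<in> Q" "q' \<in> Q" for j k q q'
    using matchedD(3)[OF x(1), of j k] that by blast
  have x_R: "x j q \<in> R" if "0 < j" "q \<in> Q" for j q
    using x(2)[OF that(1)] that(2) by blast
  \<comment> \<open>The even amount \<open>2 * (3 ^ s + 1)\<close> is \<open>p + 1\<close>, that is,
    one step modulo \<open>p\<close>.\<close>
  obtain \<pi> where \<pi>: "\<pi> \<in> G" "realizes Q x (rotate_index p (2 * (3 ^ s + 1))) \<pi>"
    using realizes_rotation[OF x(1) p(1)] by blast
  have \<pi>_x: "\<pi> (x j q) = x (Suc j mod p) q" if "j < p" "q \<in> Q" for j q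
  proof -
    have "2 * (3 ^ s + 1) = Suc p" by (simp add: p_def)
    then have "rotate_index p (2 * (3 ^ s + 1)) j = (Suc j + p) mod p"
      using that by (simp only: rotate_index_def if_True add_Suc_right add_Suc)
    also have "\<dots> = Suc j mod p" by (rule mod_add_self2)
    finally show ?thesis using \<pi>(2) that(2) by (metis realizes_def)
  qed
  \<comment> \<open>The family of pieces is infinite; those of index \<open>p\<close> and above stay
    in place.\<close>
  have \<pi>_fix: "\<pi> t = t" if "\<And>j. j < p \<Longrightarrow> t \<notin> x j ` Q" for t
  proof (cases "t \<in> (\<Union>j. x j ` Q)")
    case True
    then obtain j q where "t = x j q" "q \<in> Q" by blast
    moreover from this have "\<not> j < p" using that by blast
    ultimately show ?thesis using \<pi>(2) by (simp add: realizes_def rotate_index_def)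
  next
    case False
    then show ?thesis using \<pi>(2) supported_in_fix unfolding realizes_def by metis
  qed
  \<comment> \<open>Places a copy of \<open>Q\<close> inside \<open>Q\<close>: pieces of positive
    index lie in \<open>R\<close>, and \<open>\<zeta>\<close> maps \<open>R\<close> into
    \<open>Q\<close>.\<close>
  define u where "u i = \<zeta> \<circ> x (3 ^ i)" for i
  have uG: "u i \<in> G" for i unfolding u_def by (rule G_comp[OF \<zeta>(1) xG])
  have u_Q: "u i q \<in> Q" if "q \<in> Q" for i q
    unfolding u_def comp_apply by (rule \<zeta>_R) (rule x_R[OF _ that], simp)
  have "\<exists>\<Phi>\<in>G. (\<forall>i<s. \<forall>t\<in>u i ` Q. \<Phi> t = (u i \<circ> f i \<circ> inv (u i)) t) \<and>
    supported_in (\<Union>i<s. u i ` Q) \<Phi>"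
  proof (rule disjoint_product)
    fix i assume i: "i < s"
    show "u i \<circ> f i \<circ> inv (u i) \<in> G" using uG f(1)[OF i] by (intro G_comp G_inv)
    show "supported_in (u i ` Q) (u i \<circ> f i \<circ> inv (u i))"
      using supported_in_conj[OF f(3)[OF i] G_bij[OF uG]] by blast
    fix j assume "i \<noteq> j"
    then have "x (3 ^ i) ` Q \<inter> x (3 ^ j) ` Q = {}" by (intro matchedD(3)[OF x(1)]) simp
    then show "u i ` Q \<inter> u j ` Q = {}"
      using \<zeta>(1) by (auto simp: u_def)
  qed
  then obtain \<phi> where \<phi>: "\<phi> \<in> G" "\<And>i q. i < s \<Longrightarrow> q \<in> Q \<Longrightarrow> \<phi> (u i q) = u i (f i q)"
    "supported_in (\<Union>i<s. u i ` Q) \<phi>"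
    using uG by auto
  have \<phi>_supp: "supported_in Q \<phi>"
    using supported_in_mono[OF \<phi>(3)] u_Q by blast
  have f_Q: "f i q \<in> Q" if "i < s" "q \<in> Q" for i q
    using supported_in_image[OF f(3) G_bij[OF f(1)]] that by blast
  have \<phi>_Q: "\<phi> q \<in> Q" if "q \<in> Q" for q
    using supported_in_image[OF \<phi>_supp G_bij[OF \<phi>(1)]] that by blast
  have \<phi>_cube: "\<phi> (\<phi> (\<phi> t)) = t" for t
  proof (cases "t \<in> (\<Union>i<s. u i ` Q)")
    case True
    then obtain i q where i: "i < s" "q \<in> Q" "t = u i q" by blast
    have "f i (f i (f i q)) = q" using fun_cong[OF f(2)[OF i(1)], of q] by (simp add: numeral_3_eq_3)
    then show ?thesis using i \<phi>(2) f_Q by simp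
  next
    case False
    then show ?thesis using supported_in_fix[OF \<phi>(3)] by simp
  qed
  define \<sigma> where "\<sigma> = \<phi> \<circ> \<pi>"
  have \<sigma>G: "\<sigma> \<in> G" unfolding \<sigma>_def by (rule G_comp[OF \<phi>(1) \<pi>(1)])
  \<comment> \<open>Before the wrap-around \<open>\<pi>\<close> lands in a piece of positive index,
    outside \<open>Q\<close>, where \<open>\<phi>\<close> is the identity.\<close>
  have \<sigma>_x: "\<sigma> (x j q) = x (Suc j) q" if "Suc j < p" "q \<in> Q" for j q
  proof -
    have "x (Suc j) q \<notin> Q" using x_R[of "Suc j" q] that R(3) by blast
    then show ?thesis
      using \<pi>_x[of j q] that supported_in_fix[OF \<phi>_supp] by (simp add: \<sigma>_def)
  qed
  have \<sigma>_pow: "(\<sigma> ^^ j) (x d q) = x (d + j) q" if "d + j < p" "q \<in> Q" for d j q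
    using that(1) by (induction j) (auto simp: \<sigma>_x that(2))
  define \<Phi> where "\<Phi> = \<sigma> ^^ p"
  have \<Phi>_Q: "\<Phi> q = \<phi> q" if "q \<in> Q" for q
  proof -
    have "p = Suc (p - 1)" using p by simp
    then have "\<Phi> q = \<sigma> ((\<sigma> ^^ (p - 1)) q)"
      unfolding \<Phi>_def by (metis comp_apply funpow.simps(2))
    also have "(\<sigma> ^^ (p - 1)) q = x (p - 1) q"
      using \<sigma>_pow[of 0 "p - 1" q] that p x0 by simp
    also have "\<sigma> (x (p - 1) q) = \<phi> q"
      using \<pi>_x[of "p - 1" q] that p x0 by (simp add: \<sigma>_def)
    finally show ?thesis .
  qed
  \<comment> \<open>\<open>\<Phi>\<close> commutes with \<open>\<sigma> ^^ j\<close>, which carries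
    piece 0 to piece \<open>j\<close>.\<close>
  have \<Phi>_x: "\<Phi> (x j q) = x j (\<phi> q)" if "j < p" "q \<in> Q" for j q
  proof -
    have "\<Phi> (x j q) = \<Phi> ((\<sigma> ^^ j) q)" using \<sigma>_pow[of 0 j q] that x0 by simp
    also have "\<dots> = (\<sigma> ^^ j) (\<Phi> q)"
      unfolding \<Phi>_def by (metis add.commute comp_apply funpow_add)
    also have "\<dots> = x j (\<phi> q)"
      using \<sigma>_pow[of 0 j "\<phi> q"] \<Phi>_Q[OF that(2)] \<phi>_Q[OF that(2)] that x0 by simp
    finally show ?thesis .
  qed
  have \<Phi>_fix: "\<Phi> t = t" if t: "\<And>j. j < p \<Longrightarrow> t \<notin> x j ` Q" for t
  proof -
    have "t \<notin> Q" using t[of 0] x0 p by simp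
    then have "\<sigma> t = t"
      using \<pi>_fix[OF t] supported_in_fix[OF \<phi>_supp] by (simp add: \<sigma>_def)
    then have "(\<sigma> ^^ k) t = t" for k by (induction k) auto
    then show ?thesis by (simp add: \<Phi>_def)
  qed
  have "\<sigma> ^^ (p * 3) = id"
  proof
    fix t
    have "\<Phi> (\<Phi> (\<Phi> t)) = t"
    proof (cases "\<exists>j<p. t \<in> x j ` Q")
      case True
      then obtain j q where "j < p" "q \<in> Q" "t = x j q" by blast
      then show ?thesis using \<Phi>_x \<phi>_Q \<phi>_cube by simp
    next
      case False
      then show ?thesis using \<Phi>_fix by simp
    qed
    then have "(\<Phi> ^^ 3) t = t" by (simp add: numeral_3_eq_3)
    then show "(\<sigma> ^^ (p * 3)) t = id t" by (simp add: \<Phi>_def funpow_mult)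
  qed
  moreover have "p * 3 > 0" using p by simp
  ultimately have fin: "\<exists>m>0. \<sigma> ^^ m = id" by blast
  define w where "w i = \<zeta> \<circ> \<sigma> ^^ (3 ^ i)" for i
  txt \<open>\<open>\<psi> i\<close> agrees with \<open>f i\<close> on \<open>Q\<close>; outside \<open>Q\<close> it lives on shifts of the pieces with indices in
    \<open>{0} \<union> {3 ^ l}\<close>, and the Sidon property keeps these apart for different \<open>i\<close>.\<close>
  define \<psi> where "\<psi> i = inv (w i) \<circ> \<Phi> \<circ> w i" for i
  have powG: "\<sigma> ^^ k \<in> G" for k by (rule fun_group_funpow[OF G_group \<sigma>G])
  have wG: "w i \<in> G" for i unfolding w_def by (rule G_comp[OF \<zeta>(1) powG])
  have \<psi>G: "\<psi> i \<in> G" for i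
    unfolding \<psi>_def \<Phi>_def by (intro G_comp G_inv wG powG)
  have w_Q: "w i q = u i q" if "i < s" "q \<in> Q" for i q
    using \<sigma>_pow[of 0 "3 ^ i" q] lt_p[OF that(1)] that x0 by (simp add: w_def u_def)
  \<comment> \<open>On \<open>Q\<close> the map \<open>w i\<close> equals \<open>u i\<close> and has
    values in \<open>Q\<close>, where \<open>\<Phi>\<close> is \<open>\<phi>\<close>, the conjugate
    of \<open>f i\<close> by \<open>u i\<close>.\<close>
  have \<psi>_Q: "\<psi> i q = f i q" if "i < s" "q \<in> Q" for i q
  proof -
    have "\<Phi> (w i q) = w i (f i q)"
      using that w_Q \<Phi>_Q[OF u_Q] \<phi>(2) f_Q by simp
    then show ?thesis using wG by (simp add: \<psi>_def)
  qed
  have \<psi>_moves: "\<exists>d q. (d = 0 \<or> (\<exists>l<s. d = 3 ^ l)) \<and> q \<in> Q \<and> (\<sigma> ^^ (3 ^ i)) t = x d q"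
    if moved: "\<psi> i t \<noteq> t" for i t
  proof -
    have "\<Phi> (w i t) \<noteq> w i t" using moved wG[of i] by (auto simp: \<psi>_def)
    then obtain j q where j: "j < p" "q \<in> Q" "w i t = x j q" using \<Phi>_fix by blast
    show ?thesis
    proof (cases "j = 0")
      case True
      then have "\<phi> q \<noteq> q" using j \<open>\<Phi> (w i t) \<noteq> w i t\<close> \<Phi>_x by auto
      then obtain l q' where l: "l < s" "q' \<in> Q" "q = u l q'"
        using supported_in_fix[OF \<phi>(3), of q] by blast
      then have "\<zeta> ((\<sigma> ^^ (3 ^ i)) t) = \<zeta> (x (3 ^ l) q')"
        using j(3) True x0 by (simp add: w_def u_def)
      then show ?thesis using l \<zeta>(1) by auto
    next
      case False
      then have "\<zeta> ((\<sigma> ^^ (3 ^ i)) t) \<in> R" using j x_R by (simp add: w_def)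
      then have "(\<sigma> ^^ (3 ^ i)) t \<in> Q" by (rule \<zeta>_Q)
      then show ?thesis using x0 by (intro exI[of _ 0] exI[of _ "(\<sigma> ^^ (3 ^ i)) t"]) simp
    qed
  qed
  \<comment> \<open>If both move \<open>t\<close>, applying the other power of
    \<open>\<sigma>\<close> to each description puts the same point into pieces
    \<open>d + 3 ^ k\<close> and \<open>d' + 3 ^ i\<close>. The Sidon property yields
    \<open>d = 3 ^ i\<close>, and cancelling \<open>\<sigma> ^^ (3 ^ i)\<close> puts
    \<open>t\<close> into \<open>Q\<close>.\<close>
  have off: "\<psi> i t = t \<or> \<psi> k t = t" if ik: "i < s" "k < s" "i \<noteq> k" and t: "t \<notin> Q" for i k t
  proof (rule ccontr)
    assume "\<not> ?thesis"
    then obtain d q d' q' where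
      d: "d = 0 \<or> (\<exists>l<s. d = 3 ^ l)" "q \<in> Q" "(\<sigma> ^^ (3 ^ i)) t = x d q" and
      d': "d' = 0 \<or> (\<exists>l<s. d' = 3 ^ l)" "q' \<in> Q" "(\<sigma> ^^ (3 ^ k)) t = x d' q'"
      using \<psi>_moves[of i t] \<psi>_moves[of k t] by blast
    have "d \<le> 3 ^ s" "d' \<le> 3 ^ s" using d(1) d'(1) small by auto
    then have "d + 3 ^ k < p" "d' + 3 ^ i < p"
      using small[OF ik(1)] small[OF ik(2)] unfolding p_def by linarith+
    then have "x (d + 3 ^ k) q = (\<sigma> ^^ (3 ^ k)) ((\<sigma> ^^ (3 ^ i)) t)"
      "x (d' + 3 ^ i) q' = (\<sigma> ^^ (3 ^ i)) ((\<sigma> ^^ (3 ^ k)) t)"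
      using \<sigma>_pow d d' by simp_all
    moreover have "(\<sigma> ^^ (3 ^ k)) ((\<sigma> ^^ (3 ^ i)) t) = (\<sigma> ^^ (3 ^ i)) ((\<sigma> ^^ (3 ^ k)) t)"
      by (metis add.commute comp_apply funpow_add)
    ultimately have "x (d + 3 ^ k) q = x (d' + 3 ^ i) q'" by simp
    then have "d + 3 ^ k = d' + 3 ^ i" using x_inj d(2) d'(2) by blast
    then have "d = 3 ^ i"
      by (rule sidon_zero_three_powers) (use ik(3) d(1) d'(1) in blast)+
    then have "(\<sigma> ^^ (3 ^ i)) t = (\<sigma> ^^ (3 ^ i)) q"
      using d \<sigma>_pow[of 0 "3 ^ i" q] lt_p[OF ik(1)] x0 by simp
    then have "t = q" using G_eq[OF powG] by blast
    then show False using d(2) t by simp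
  qed
  have H: "fun_group (gen {\<sigma>, \<zeta>})" "\<sigma> \<in> gen {\<sigma>, \<zeta>}" "\<zeta> \<in> gen {\<sigma>, \<zeta>}"
    using fun_group_gen gen_incl[of "{\<sigma>, \<zeta>}"] by auto
  have "w i \<in> gen {\<sigma>, \<zeta>}" "\<Phi> \<in> gen {\<sigma>, \<zeta>}" for i
    using H fun_group_funpow[OF H(1,2)] unfolding w_def \<Phi>_def fun_group_def by blast+
  then have \<psi>_gen: "\<psi> i \<in> gen {\<sigma>, \<zeta>}" for i
    using H(1) unfolding \<psi>_def fun_group_def by blast
  have "commutator (f i) (f k) \<in> gen {\<sigma>, \<zeta>}" if ik: "i < s" "k < s" for i k
  proof (cases "i = k")
    case True
    then show ?thesis
      using commutator_self[OF G_bij[OF f(1)[OF ik(1)]]] H(1) by (simp add: fun_group_def)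
  next
    case False
    have "commutator (\<psi> i) (\<psi> k) = commutator (f i) (f k)"
      by (rule commutator_restrict[of _ _ _ _ Q])
        (use ik f \<psi>_Q off[OF ik False] G_bij \<psi>G in auto)
    then show ?thesis using fun_group_commutator[OF H(1) \<psi>_gen \<psi>_gen] by metis
  qed
  then show ?thesis using \<sigma>G fin by blast
qed

text \<open>Elements of \<open>G\<close> permute the proper clopen sets, so the generated subgroup
  is normal; it is also non-trivial, and simplicity applies.\<close>

lemma generated_by_proper_torsion_commutators:
  assumes "\<Omega> \<noteq> {}"
    and simple: "\<And>N. N \<subseteq> G \<Longrightarrow> fun_group N \<Longrightarrow> (\<And>g f. g \<in> G \<Longrightarrow> f \<in> N \<Longrightarrow> g \<circ> f \<circ> inv g \<in> N)
      \<Longrightarrow> N \<noteq> {id} \<Longrightarrow> N = G"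
  shows "gen (\<Union>B\<in>K - {\<Omega>}. torsion_commutators B) = G"
proof (rule simple)
  let ?S = "\<Union>B\<in>K - {\<Omega>}. torsion_commutators B"
  have grp: "fun_group (gen ?S)" by (rule fun_group_gen)
  then show "fun_group (gen ?S)" .
  have "?S \<subseteq> G" using torsion_commutators_supported by blast
  then show sub: "gen ?S \<subseteq> G" using G_group gen_least by blast
  show "g \<circ> f \<circ> inv g \<in> gen ?S" if g: "g \<in> G" and "f \<in> gen ?S" for g f
  proof -
    \<comment> \<open>The elements whose conjugate by \<open>g\<close> stays in the subgroup form a
      group, which reduces normality to the generators.\<close>
    let ?H = "{f \<in> G. g \<circ> f \<circ> inv g \<in> gen ?S}"
    have "fun_group ?H"
      unfolding fun_group_def
    proof (intro conjI ballI)
      have "g \<circ> id \<circ> inv g = id" using g by (simp add: fun_eq_iff)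
      then show "id \<in> ?H" using grp G_id unfolding fun_group_def by simp
      fix f assume f: "f \<in> ?H"
      have "inv (g \<circ> f \<circ> inv g) \<in> gen ?S"
        using grp f unfolding fun_group_def by blast
      then show "inv f \<in> ?H" using f G_inv conj_inv[OF G_bij[OF g] G_bij[of f]] by simp
      fix f' assume f': "f' \<in> ?H"
      have "(g \<circ> f \<circ> inv g) \<circ> (g \<circ> f' \<circ> inv g) \<in> gen ?S"
        using grp f f' unfolding fun_group_def by blast
      then show "f \<circ> f' \<in> ?H" using f f' G_comp conj_comp[OF G_bij[OF g], of f f'] by simp
    qed
    moreover have "?S \<subseteq> ?H"
    proof
      fix c assume "c \<in> ?S"
      then obtain B where B: "B \<in> K" "B \<noteq> \<Omega>" "c \<in> torsion_commutators B" by blast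
      have "g ` \<Omega> = \<Omega>" using supported_in_image[OF G_supported[OF g] G_bij[OF g]] .
      then have "g ` B \<noteq> \<Omega>" using B(2) bij_is_inj[OF G_bij[OF g]] by (metis inj_image_eq_iff)
      moreover have "g \<circ> c \<circ> inv g \<in> torsion_commutators (g ` B)"
        using torsion_commutators_conj[OF B(3) g] by simp
      ultimately have "g \<circ> c \<circ> inv g \<in> ?S" using G_K[OF g B(1)] by blast
      then show "c \<in> ?H" using \<open>?S \<subseteq> G\<close> \<open>c \<in> ?S\<close> gen_incl[of ?S] by blast
    qed
    ultimately show ?thesis using gen_least[of ?S ?H] \<open>f \<in> gen ?S\<close> by blast
  qed
  show "gen ?S \<noteq> {id}"
  proof -
    obtain B :: "nat \<Rightarrow> 'a set" where B: "\<And>j. B j \<in> K" "\<And>j. B j \<noteq> {}" "\<And>j. B j \<subseteq> \<Omega>"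
      "\<And>j k. j \<noteq> k \<Longrightarrow> B j \<inter> B k = {}"
      using K_disjoint_sequence[OF top_in_K assms(1)] by metis
    obtain k where k: "k \<in> torsion_commutators (B 0 \<union> B 1)" "k ` B 0 \<subseteq> B 1"
      using torsion_commutator_moves_off[OF B(1,1,2,2), of 0 1] B(4)[of 0 1] by auto
    \<comment> \<open>The third set \<open>B 2\<close> leaves room outside.\<close>
    have "B 0 \<union> B 1 \<noteq> \<Omega>" using B(2,3)[of 2] B(4)[of 0 2] B(4)[of 1 2] by auto
    moreover have "B 0 \<union> B 1 \<in> K" by (rule K_union[OF B(1) B(1)])
    ultimately have "k \<in> ?S" using k(1) by blast
    moreover have "k \<noteq> id" using k(2) B(2)[of 0] B(4)[of 0 1] by auto
    ultimately show ?thesis using gen_incl[of ?S] by blast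
  qed
qed

lemma exists_displaced_clopen:
  assumes "\<zeta> \<in> G" "\<zeta> \<noteq> id"
  shows "\<exists>R\<in>K. R \<noteq> {} \<and> \<zeta> ` R \<inter> R = {} \<and> R \<union> \<zeta> ` R \<noteq> \<Omega>"
proof -
  obtain a where a: "\<zeta> a \<noteq> a" using assms(2) by (auto simp: fun_eq_iff)
  then have "a \<in> \<Omega>" using supported_in_fix[OF G_supported[OF assms(1)]] by blast
  moreover have "\<zeta> a \<in> \<Omega>"
    using supported_in_image[OF G_supported[OF assms(1)] G_bij[OF assms(1)]] \<open>a \<in> \<Omega>\<close> by blast
  ultimately obtain U where U: "U \<in> K" "a \<in> U" "\<zeta> a \<notin> U" using K_separates a by metis
  define A where "A = U - inv \<zeta> ` U"
  have mem: "t \<in> A \<longleftrightarrow> t \<in> U \<and> \<zeta> t \<notin> U" for t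
  proof -
    have "t \<in> inv \<zeta> ` U" if "\<zeta> t \<in> U"
      using imageI[OF that, of "inv \<zeta>"] assms(1) by simp
    then show ?thesis using assms(1) unfolding A_def by auto
  qed
  have "A \<in> K" unfolding A_def by (intro K_diff U(1) G_K G_inv assms(1))
  moreover have "A \<noteq> {}" using U mem by blast
  ultimately obtain R where R: "R \<in> K" "R \<noteq> {}" "R \<subset> A" using K_split by blast
  have "\<zeta> ` A \<inter> A = {}" using mem by auto
  then have "\<zeta> ` R \<inter> A = {}" using R(3) by blast
  then have "\<zeta> ` R \<inter> R = {}" "R \<union> \<zeta> ` R \<noteq> \<Omega>"
    using R(3) K_subset[OF \<open>A \<in> K\<close>] by blast+
  then show ?thesis using R by blast
qed

theorem two_generated:
  assumes "\<Omega> \<noteq> {}" "2 \<le> n"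
    and simple: "\<And>N. N \<subseteq> G \<Longrightarrow> fun_group N \<Longrightarrow> (\<And>g f. g \<in> G \<Longrightarrow> f \<in> N \<Longrightarrow> g \<circ> f \<circ> inv g \<in> N)
      \<Longrightarrow> N \<noteq> {id} \<Longrightarrow> N = G"
    and fg: "finite S" "S \<subseteq> G" "G \<subseteq> gen S"
  shows "\<exists>\<sigma>\<in>G. \<exists>\<zeta>\<in>G. (\<exists>m>0. \<sigma> ^^ m = id) \<and> (\<forall>k. \<zeta> ^^ k = id \<longleftrightarrow> n dvd k) \<and> G \<subseteq> gen {\<sigma>, \<zeta>}"
proof -
  obtain I where I: "I \<in> K" "I \<noteq> {}" "I \<subset> \<Omega>" using K_split[OF top_in_K assms(1)] by blast
  then obtain \<zeta> where \<zeta>: "\<zeta> \<in> G" "\<And>k. \<zeta> ^^ k = id \<longleftrightarrow> n dvd k"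
    using exists_order[of I n] assms(2) by auto
  have "\<zeta> \<noteq> id" using \<zeta>(2)[of 1] assms(2) by auto
  then obtain R where R: "R \<in> K" "R \<noteq> {}" "\<zeta> ` R \<inter> R = {}" "R \<union> \<zeta> ` R \<noteq> \<Omega>"
    using exists_displaced_clopen[OF \<zeta>(1)] by blast
  define Q where "Q = \<Omega> - R"
  have R_top: "R \<subseteq> \<Omega>" and \<zeta>_top: "\<zeta> ` \<Omega> = \<Omega>"
    using K_subset[OF R(1)] supported_in_image[OF G_supported[OF \<zeta>(1)] G_bij[OF \<zeta>(1)]] by auto
  define P where "P = \<zeta> ` R"
  have \<zeta>Q: "\<zeta> ` Q = \<Omega> - P"
    using image_set_diff[OF bij_is_inj[OF G_bij[OF \<zeta>(1)]], of \<Omega> R] \<zeta>_top by (simp add: Q_def P_def)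
  have P: "P \<noteq> {}" "P \<subseteq> \<Omega>" "P \<inter> R = {}" "R \<union> P \<noteq> \<Omega>"
    using R R_top \<zeta>_top by (auto simp: P_def)
  obtain y z where yz: "y \<in> P" "y \<in> \<Omega>" "z \<in> \<Omega>" "z \<notin> R" "z \<notin> P"
    using P(1,2,4) R_top by auto
  have Q: "Q \<in> K" "Q \<noteq> {}" "Q \<noteq> \<Omega>" "\<Omega> - Q = R"
    using K_diff[OF top_in_K R(1)] R(2) R_top P by (auto simp: Q_def)
  let ?T = "insert \<zeta> (torsion_commutators Q)"
  have conj: "torsion_commutators (\<zeta> ` Q) \<subseteq> gen ?T"
  proof
    fix c assume "c \<in> torsion_commutators (\<zeta> ` Q)"
    then have "inv \<zeta> \<circ> c \<circ> inv (inv \<zeta>) \<in> torsion_commutators Q"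
      by (rule torsion_commutators_conj) (use \<zeta>(1) G_inv in auto)
    then have d: "inv \<zeta> \<circ> c \<circ> \<zeta> \<in> torsion_commutators Q"
      using inv_inv_eq[OF G_bij[OF \<zeta>(1)]] by simp
    have "c = \<zeta> \<circ> (inv \<zeta> \<circ> c \<circ> \<zeta>) \<circ> inv \<zeta>" using \<zeta>(1) by (simp add: fun_eq_iff)
    moreover have "\<zeta> \<circ> (inv \<zeta> \<circ> c \<circ> \<zeta>) \<circ> inv \<zeta> \<in> gen ?T"
    proof -
      have "\<zeta> \<in> gen ?T" "inv \<zeta> \<circ> c \<circ> \<zeta> \<in> gen ?T" using gen_incl[of ?T] d by blast+
      then show ?thesis using fun_group_gen[of ?T] unfolding fun_group_def by blast
    qed
    ultimately show "c \<in> gen ?T" by simp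
  qed
  have "(\<Union>B\<in>K - {\<Omega>}. torsion_commutators B) \<subseteq> gen ?T"
  proof
    fix c assume "c \<in> (\<Union>B\<in>K - {\<Omega>}. torsion_commutators B)"
    then obtain B where B: "B \<in> K" "B \<noteq> \<Omega>" "c \<in> torsion_commutators B" by blast
    \<comment> \<open>Conjugation by such an \<open>m\<close> turns \<open>c\<close> into a
      commutator over \<open>Q\<close>, and \<open>m\<close> itself is already generated.\<close>
    have "\<exists>m\<in>G \<inter> gen ?T. m ` B \<subseteq> Q"
    proof (rule moves_into_overlapping_cover[where E = "\<zeta> ` Q"])
      show "\<zeta> ` Q \<in> K" by (rule G_K[OF \<zeta>(1) Q(1)])
      show "\<zeta> ` Q \<noteq> \<Omega>" "Q \<union> \<zeta> ` Q = \<Omega>" "Q \<inter> \<zeta> ` Q \<noteq> {}"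
        unfolding \<zeta>Q unfolding Q_def using yz P(3) by auto
      show "torsion_commutators Q \<subseteq> gen ?T" using gen_incl[of ?T] by blast
    qed (use Q B conj fun_group_gen in auto)
    then obtain m where m: "m \<in> G" "m \<in> gen ?T" "m ` B \<subseteq> Q" by blast
    have "m \<circ> c \<circ> inv m \<in> gen ?T"
      using torsion_commutators_conj[OF B(3) m(1,3)] gen_incl[of ?T] by blast
    then have "inv m \<circ> (m \<circ> c \<circ> inv m) \<circ> m \<in> gen ?T"
      using m(2) fun_group_gen[of ?T] unfolding fun_group_def by blast
    moreover have "inv m \<circ> (m \<circ> c \<circ> inv m) \<circ> m = c" using m(1) by (simp add: fun_eq_iff)
    ultimately show "c \<in> gen ?T" by simp
  qed
  then have "G \<subseteq> gen ?T"
    using gen_least[OF _ fun_group_gen] generated_by_proper_torsion_commutators[OF assms(1) simple]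
    by blast
  then obtain F where F: "F \<subseteq> ?T" "finite F" "S \<subseteq> gen F"
    using gen_finite_finite_subset[OF fg(1), of ?T] fg(2) by blast
  let ?W = "{f \<in> G. f ^^ 3 = id \<and> supported_in Q f}"
  have "\<forall>c\<in>torsion_commutators Q. \<exists>h. fst h \<in> ?W \<and> snd h \<in> ?W \<and> c = commutator (fst h) (snd h)"
    unfolding torsion_commutators_def by fastforce
  from bchoice[OF this] obtain h where
    h: "\<And>c. c \<in> torsion_commutators Q \<Longrightarrow> fst (h c) \<in> ?W \<and> snd (h c) \<in> ?W \<and> c = commutator (fst (h c)) (snd (h c))"
    by auto
  \<comment> \<open>Both entries of every commutator needed; once enumerated, all their pairwise
    commutators are obtained from one \<open>\<sigma>\<close>.\<close>
  define W where "W = (fst \<circ> h) ` (F - {\<zeta>}) \<union> (snd \<circ> h) ` (F - {\<zeta>})"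
  have W: "finite W" "W \<subseteq> ?W"
    using F(1,2) h by (auto simp: W_def)
  have W_comm: "\<exists>a b. c = commutator a b \<and> a \<in> W \<and> b \<in> W" if "c \<in> F" "c \<noteq> \<zeta>" for c
  proof (intro exI conjI)
    show "c = commutator (fst (h c)) (snd (h c))" using h F(1) that by blast
  qed (use that in \<open>auto simp: W_def\<close>)
  obtain s :: nat and f where f: "W = f ` {i. i < s}"
    using finite_imp_nat_seg_image_inj_on[OF W(1)] by blast
  have f_props: "f i \<in> G" "f i ^^ 3 = id" "supported_in Q (f i)" if "i < s" for i
    using W(2) f that by auto
  have "\<exists>\<sigma>\<in>G. (\<exists>m>0. \<sigma> ^^ m = id) \<and> (\<forall>i<s. \<forall>k<s. commutator (f i) (f k) \<in> gen {\<sigma>, \<zeta>})"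
    by (rule two_element_realization[OF Q(1-3) \<zeta>(1)]) (use R(3) Q(4) f_props in auto)
  then obtain \<sigma> where \<sigma>: "\<sigma> \<in> G" "\<exists>m>0. \<sigma> ^^ m = id"
    "\<And>i k. i < s \<Longrightarrow> k < s \<Longrightarrow> commutator (f i) (f k) \<in> gen {\<sigma>, \<zeta>}"
    by auto
  have "F \<subseteq> gen {\<sigma>, \<zeta>}"
  proof
    fix c assume "c \<in> F"
    show "c \<in> gen {\<sigma>, \<zeta>}"
    proof (cases "c = \<zeta>")
      case True
      then show ?thesis using gen_incl[of "{\<sigma>, \<zeta>}"] by blast
    next
      case False
      then obtain a b where "c = commutator a b" "a \<in> W" "b \<in> W" using W_comm \<open>c \<in> F\<close> by blast
      then show ?thesis using \<sigma>(3) f by blast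
    qed
  qed
  then have "S \<subseteq> gen {\<sigma>, \<zeta>}" using gen_least[OF _ fun_group_gen] F(3) by blast
  then have "G \<subseteq> gen {\<sigma>, \<zeta>}" using gen_least[OF _ fun_group_gen] fg(3) by blast
  then show ?thesis using \<sigma>(1,2) \<zeta> by blast
qed

end

section \<open>Homeomorphisms of Cantor space\<close>

lemma cantor_top_space: "topspace cantor_top = UNIV"
  by (simp add: cantor_top_def)

text \<open>A basic open set constrains finitely many coordinates, so a free coordinate of
  \<open>w\<close> can be flipped.\<close>

lemma cantor_top_perfect:
  assumes "openin cantor_top U" "w \<in> U"
  shows "\<exists>v\<in>U. v \<noteq> w"
proof -
  obtain B where B: "finite {i. B i \<noteq> (UNIV :: bool set)}" "w \<in> Pi\<^sub>E UNIV B" "Pi\<^sub>E UNIV B \<subseteq> U"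
    using assms unfolding cantor_top_def openin_product_topology_alt by fastforce
  obtain n :: nat where n: "B n = UNIV"
    using B(1) infinite_UNIV_nat ex_new_if_finite by blast
  have "w(n := \<not> w n) \<in> Pi\<^sub>E UNIV B" using B(2) n by (auto simp: PiE_UNIV_domain Pi_iff)
  then show ?thesis using B(3) by (intro bexI[of _ "w(n := \<not> w n)"]) (metis fun_upd_same, blast)
qed

lemma clopen_in_diff: "clopen_in T A \<Longrightarrow> clopen_in T B \<Longrightarrow> clopen_in T (A - B)"
  by (simp add: clopen_in_def openin_diff closedin_diff)

text \<open>Some coordinate of the homeomorphism to \<open>cantor_top\<close> tells \<open>x\<close>
  from \<open>y\<close>; its fibres are clopen.\<close>

lemma cantor_space_separates:
  assumes "is_cantor_space T" "x \<in> topspace T" "y \<in> topspace T" "x \<noteq> y"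
  shows "\<exists>U. clopen_in T U \<and> x \<in> U \<and> y \<notin> U"
proof -
  obtain h where h: "homeomorphic_map T cantor_top h"
    using assms(1) by (auto simp: is_cantor_space_def homeomorphic_space)
  have "h x \<noteq> h y"
    using homeomorphic_imp_injective_map[OF h] assms(2-4) by (auto simp: inj_on_def)
  then obtain n where n: "h x n \<noteq> h y n" by auto
  have "continuous_map T (discrete_topology UNIV) (\<lambda>t. h t n)"
    using homeomorphic_imp_continuous_map[OF h]
    by (simp add: cantor_top_def continuous_map_componentwise_UNIV)
  from openin_continuous_map_preimage[OF this, of "{h x n}"]
    closedin_continuous_map_preimage[OF this, of "{h x n}"]
  have "openin T {t \<in> topspace T. h t n \<in> {h x n}}" "closedin T {t \<in> topspace T. h t n \<in> {h x n}}"
    by simp_all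
  then show ?thesis using assms n
    by (intro exI[of _ "{t \<in> topspace T. h t n \<in> {h x n}}"]) (simp add: clopen_in_def)
qed

lemma cantor_space_perfect:
  assumes "is_cantor_space T" "openin T A" "x \<in> A"
  shows "\<exists>y\<in>A. y \<noteq> x"
proof -
  obtain h where h: "homeomorphic_map T cantor_top h"
    using assms(1) by (auto simp: is_cantor_space_def homeomorphic_space)
  have "openin cantor_top (h ` A)"
    using homeomorphic_imp_open_map[OF h] assms(2) by (simp add: open_map_def)
  then obtain v where "v \<in> h ` A" "v \<noteq> h x" using cantor_top_perfect assms(3) by blast
  then show ?thesis by auto
qed

lemma cantor_space_nonempty:
  assumes "is_cantor_space T" shows "topspace T \<noteq> {}"
proof -
  obtain h where "homeomorphic_map T cantor_top h"
    using assms by (auto simp: is_cantor_space_def homeomorphic_space)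
  then have "h ` topspace T = UNIV"
    using homeomorphic_imp_surjective_map cantor_top_space by metis
  then show ?thesis by (metis UNIV_not_empty image_empty)
qed

text \<open>The normalisation outside the space makes \<open>f\<close> bijective on the whole type,
  so that \<open>inv f\<close> is its true inverse.\<close>

lemma Homeo_bij:
  assumes "f \<in> Homeo T" shows "bij f"
proof -
  have f: "homeomorphic_map T T f" "\<And>t. t \<notin> topspace T \<Longrightarrow> f t = t"
    using assms by (auto simp: Homeo_def)
  have inj: "inj_on f (topspace T)" and im: "f ` topspace T = topspace T"
    using f(1) homeomorphic_imp_injective_map homeomorphic_imp_surjective_map by blast+
  have mem: "f t \<in> topspace T \<longleftrightarrow> t \<in> topspace T" for t using im f(2)[of t] by auto
  have "inj f"
    using inj f(2) mem unfolding inj_def inj_on_def by metis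
  moreover have "surj f"
    using im f(2) unfolding surj_def by (metis imageE)
  ultimately show ?thesis by (rule bijI)
qed

lemma Homeo_id: "id \<in> Homeo T"
  by (simp add: Homeo_def)

lemma Homeo_comp: "f \<in> Homeo T \<Longrightarrow> g \<in> Homeo T \<Longrightarrow> f \<circ> g \<in> Homeo T"
  by (auto simp: Homeo_def intro: homeomorphic_map_compose)

lemma Homeo_inv:
  assumes "f \<in> Homeo T" shows "inv f \<in> Homeo T"
proof -
  have f: "homeomorphic_map T T f" "\<And>t. t \<notin> topspace T \<Longrightarrow> f t = t"
    using assms by (auto simp: Homeo_def)
  have inv_f: "inv f (f t) = t" "f (inv f t) = t" for t
    using Homeo_bij[OF assms] by (simp_all add: bij_is_inj bij_is_surj surj_f_inv_f)
  obtain g where g: "homeomorphic_maps T T f g" using f(1) by (auto simp: homeomorphic_map_maps)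
  have "g t = inv f t" if "t \<in> topspace T" for t
    using g that inv_f by (metis homeomorphic_maps_def)
  then have "homeomorphic_map T T (inv f)"
    using g homeomorphic_map_eq homeomorphic_map_maps homeomorphic_maps_sym by metis
  moreover have "inv f t = t" if "t \<notin> topspace T" for t using inv_f f(2)[OF that] by metis
  ultimately show ?thesis by (simp add: Homeo_def)
qed

section \<open>Passage to the groups of HOL-Algebra\<close>

lemma group_homeo_group: "group (homeo_group T)"
proof (rule groupI)
  fix f assume f: "f \<in> carrier (homeo_group T)"
  then show "\<exists>g\<in>carrier (homeo_group T). g \<otimes>\<^bsub>homeo_group T\<^esub> f = \<one>\<^bsub>homeo_group T\<^esub>"
    using Homeo_inv[of f T] Homeo_bij[of f T]
    by (intro bexI[of _ "inv f"]) (auto simp: homeo_group_def fun_eq_iff bij_is_surj surj_f_inv_f)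
qed (auto simp: homeo_group_def Homeo_id Homeo_comp o_assoc)

lemma m_inv_homeo_group:
  assumes "f \<in> Homeo T" shows "m_inv (homeo_group T) f = inv f"
proof (rule group.inv_equality[OF group_homeo_group])
  show "inv f \<otimes>\<^bsub>homeo_group T\<^esub> f = \<one>\<^bsub>homeo_group T\<^esub>"
    using Homeo_bij[OF assms] by (simp add: homeo_group_def fun_eq_iff bij_is_surj surj_f_inv_f)
qed (use assms Homeo_inv in \<open>simp_all add: homeo_group_def\<close>)

lemma pow_homeo_group: "f [^]\<^bsub>homeo_group T\<^esub> (k :: nat) = f ^^ k"
proof (induction k)
  case 0
  then show ?case by (simp add: homeo_group_def nat_pow_def)
next
  case (Suc k)
  have "f [^]\<^bsub>homeo_group T\<^esub> Suc k = f [^]\<^bsub>homeo_group T\<^esub> k \<otimes>\<^bsub>homeo_group T\<^esub> f"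
    by (simp add: nat_pow_def)
  then show ?case using Suc by (simp add: homeo_group_def)
qed

lemma subgroup_homeo_group_iff:
  "subgroup H (homeo_group T) \<longleftrightarrow> H \<subseteq> Homeo T \<and> fun_group H"
proof
  assume H: "subgroup H (homeo_group T)"
  have "H \<subseteq> Homeo T" using subgroup.subset[OF H] by (simp add: homeo_group_def)
  moreover have "inv f \<in> H" if "f \<in> H" for f
    using subgroup.m_inv_closed[OF H that] m_inv_homeo_group[of f T] that \<open>H \<subseteq> Homeo T\<close> by auto
  \<comment> \<open>The arguments are swapped because the product of \<open>homeo_group\<close>
    applies its left factor first.\<close>
  moreover have "f \<circ> g \<in> H" if "f \<in> H" "g \<in> H" for f g
    using subgroup.m_closed[OF H that(2,1)] by (simp add: homeo_group_def)
  moreover have "id \<in> H" using subgroup.one_closed[OF H] by (simp add: homeo_group_def)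
  ultimately show "H \<subseteq> Homeo T \<and> fun_group H" by (simp add: fun_group_def)
next
  assume H: "H \<subseteq> Homeo T \<and> fun_group H"
  show "subgroup H (homeo_group T)"
  proof (rule group.subgroupI[OF group_homeo_group])
    show "H \<subseteq> carrier (homeo_group T)" using H by (simp add: homeo_group_def)
    show "H \<noteq> {}" using H by (auto simp: fun_group_def)
    show "m_inv (homeo_group T) f \<in> H" if "f \<in> H" for f
      using H that m_inv_homeo_group[of f T] by (auto simp: fun_group_def)
    show "f \<otimes>\<^bsub>homeo_group T\<^esub> g \<in> H" if "f \<in> H" "g \<in> H" for f g
      using H that by (simp add: homeo_group_def fun_group_def)
  qed
qed

lemma generate_homeo_group:
  assumes "S \<subseteq> Homeo T"
  shows "generate (homeo_group T) S = gen S"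
proof
  have S: "S \<subseteq> carrier (homeo_group T)" using assms by (simp add: homeo_group_def)
  have "subgroup (gen S) (homeo_group T)"
    unfolding subgroup_homeo_group_iff
  proof
    have "fun_group (Homeo T)" by (simp add: fun_group_def Homeo_id Homeo_inv Homeo_comp)
    then show "gen S \<subseteq> Homeo T" by (rule gen_least[OF assms])
    show "fun_group (gen S)" by (rule fun_group_gen)
  qed
  then show "generate (homeo_group T) S \<subseteq> gen S"
    by (rule group.generate_subgroup_incl[OF group_homeo_group gen_incl])
  show "gen S \<subseteq> generate (homeo_group T) S"
  proof (rule gen_least)
    show "S \<subseteq> generate (homeo_group T) S" by (auto intro: generate.incl)
    show "fun_group (generate (homeo_group T) S)"
      using group.generate_is_subgroup[OF group_homeo_group S] by (simp add: subgroup_homeo_group_iff)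
  qed
qed

lemma simple_homeo_subgroup:
  assumes G: "subgroup G (homeo_group T)" "simple_grp ((homeo_group T)\<lparr>carrier := G\<rparr>)"
    and N: "N \<subseteq> G" "fun_group N" "\<And>g f. g \<in> G \<Longrightarrow> f \<in> N \<Longrightarrow> g \<circ> f \<circ> inv g \<in> N" "N \<noteq> {id}"
  shows "N = G"
proof -
  let ?M = "(homeo_group T)\<lparr>carrier := G\<rparr>"
  have GH: "G \<subseteq> Homeo T" "fun_group G" using G(1) by (simp_all add: subgroup_homeo_group_iff)
  have inv_M: "m_inv ?M f = inv f" if "f \<in> G" for f
    using group.m_inv_consistent[OF group_homeo_group G(1) that] m_inv_homeo_group GH(1) that by auto
  have grp: "group ?M" using G(2) by (simp add: simple_grp_def)
  have "subgroup N ?M"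
  proof (rule group.subgroupI[OF grp])
    show "N \<subseteq> carrier ?M" using N(1) by simp
    show "N \<noteq> {}" using N(2) by (auto simp: fun_group_def)
    show "m_inv ?M f \<in> N" if "f \<in> N" for f
      using N(1,2) that inv_M by (auto simp: fun_group_def)
    show "f \<otimes>\<^bsub>?M\<^esub> g \<in> N" if "f \<in> N" "g \<in> N" for f g
      using N(2) that by (simp add: homeo_group_def fun_group_def)
  qed
  moreover have "g \<otimes>\<^bsub>?M\<^esub> f \<otimes>\<^bsub>?M\<^esub> m_inv ?M g \<in> N" if g: "g \<in> G" and f: "f \<in> N" for g f
  proof -
    \<comment> \<open>With the reversed product, conjugation by \<open>g\<close> is the function
      \<open>inv g \<circ> f \<circ> g\<close>, so the hypothesis on \<open>N\<close> is applied to
      \<open>inv g\<close>.\<close>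
    have "inv g \<in> G" using GH(2) g by (simp add: fun_group_def)
    from N(3)[OF this f] have "inv g \<circ> f \<circ> g \<in> N"
      using inv_inv_eq[OF Homeo_bij, of g T] g GH(1) by auto
    then show ?thesis using inv_M[OF g] by (simp add: homeo_group_def o_assoc)
  qed
  ultimately have "N \<lhd> ?M" by (simp add: group.normal_inv_iff[OF grp])
  then have "N = {\<one>\<^bsub>?M\<^esub>} \<or> N = carrier ?M" using G(2) by (simp add: simple_grp_def)
  then show ?thesis using N(4) by (simp add: homeo_group_def)
qed

lemma Homeo_clopen_image:
  assumes "f \<in> Homeo T" "clopen_in T A" shows "clopen_in T (f ` A)"
  using assms homeomorphic_imp_open_map homeomorphic_imp_closed_map
  unfolding Homeo_def clopen_in_def open_map_def closed_map_def by blast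

lemma vigorous_clopen_action:
  assumes "is_cantor_space T" "subgroup G (homeo_group T)" "vigorous T G"
  shows "clopen_action (topspace T) {A. clopen_in T A} G"
proof
  have GH: "G \<subseteq> Homeo T" "fun_group G"
    using assms(2) by (simp_all add: subgroup_homeo_group_iff)
  show "fun_group G" by (fact GH(2))
  show "topspace T \<in> {A. clopen_in T A}" by (simp add: clopen_in_def)
  show "A \<subseteq> topspace T" if "A \<in> {A. clopen_in T A}" for A
    using that by (simp add: clopen_in_def openin_subset)
  show "A - B \<in> {A. clopen_in T A}" if "A \<in> {A. clopen_in T A}" "B \<in> {A. clopen_in T A}" for A B
    using that clopen_in_diff by simp
  show "\<exists>U\<in>{A. clopen_in T A}. x \<in> U \<and> y \<notin> U" if "x \<in> topspace T" "y \<in> topspace T" "x \<noteq> y" for x y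
    using cantor_space_separates[OF assms(1) that] by simp
  show "\<exists>y\<in>A. y \<noteq> x" if "A \<in> {A. clopen_in T A}" "x \<in> A" for A x
    using cantor_space_perfect[OF assms(1) _ that(2)] that(1) by (simp add: clopen_in_def)
  show "bij f" if "f \<in> G" for f using Homeo_bij GH(1) that by blast
  show "supported_in (topspace T) f" if "f \<in> G" for f
    using GH(1) that by (auto simp: Homeo_def supported_in_def)
  show "f ` A \<in> {A. clopen_in T A}" if "f \<in> G" "A \<in> {A. clopen_in T A}" for f A
    using Homeo_clopen_image GH(1) that by blast
  fix A B C assume ABC: "A \<in> {A. clopen_in T A}" "B \<in> {A. clopen_in T A}" "C \<in> {A. clopen_in T A}"
    "B \<noteq> {}" "B \<subset> A" "C \<noteq> {}" "C \<subset> A"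
  then have "clopen_in T A \<and> clopen_in T B \<and> clopen_in T C \<and> B \<noteq> {} \<and> B \<subset> A \<and> C \<noteq> {} \<and> C \<subset> A"
    by simp
  with assms(3) have "\<exists>f\<in>G. supp T f \<subseteq> A \<and> f ` B \<subseteq> C" unfolding vigorous_def by presburger
  then obtain f where f: "f \<in> G" "supp T f \<subseteq> A" "f ` B \<subseteq> C" by auto
  \<comment> \<open>Outside the space, where \<open>supp\<close> says nothing, the normalisation in
    \<open>Homeo\<close> makes \<open>f\<close> the identity.\<close>
  have "f t = t" if "t \<notin> A" for t
    using that f(1,2) GH(1) by (cases "t \<in> topspace T") (auto simp: supp_def Homeo_def)
  then have "supported_in A f" by (simp add: supported_in_def)
  then show "\<exists>f\<in>G. supported_in A f \<and> f ` B \<subseteq> C" using f by auto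
qed

theorem theorem1p8:
  fixes T :: "'a topology" and G :: "('a \<Rightarrow> 'a) set" and n :: nat
  assumes "is_cantor_space T"
    and "subgroup G (homeo_group T)"
    and "finitely_generated ((homeo_group T)\<lparr>carrier := G\<rparr>)"
    and "simple_grp ((homeo_group T)\<lparr>carrier := G\<rparr>)"
    and "vigorous T G"
    and "n \<ge> 2"
  shows "\<exists>\<sigma>\<in>G. \<exists>\<zeta>\<in>G. group.ord (homeo_group T) \<sigma> \<noteq> 0
           \<and> group.ord (homeo_group T) \<zeta> = n
           \<and> generate (homeo_group T) {\<sigma>, \<zeta>} = G"
proof -
  interpret clopen_action "topspace T" "{A. clopen_in T A}" G
    by (rule vigorous_clopen_action[OF assms(1,2,5)])
  have GH: "G \<subseteq> Homeo T" using assms(2) by (simp add: subgroup_homeo_group_iff)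
  obtain S where S: "finite S" "S \<subseteq> G" "generate ((homeo_group T)\<lparr>carrier := G\<rparr>) S = G"
    using assms(3) by (auto simp: finitely_generated_def)
  then have "generate (homeo_group T) S = G"
    using group.generate_consistent[OF group_homeo_group S(2) assms(2)] by simp
  then have "G \<subseteq> gen S" using generate_homeo_group[of S T] S(2) GH by auto
  from two_generated[OF cantor_space_nonempty[OF assms(1)] assms(6)
      simple_homeo_subgroup[OF assms(2,4)] S(1,2) this]
  obtain \<sigma> \<zeta> where *: "\<sigma> \<in> G" "\<zeta> \<in> G" "\<exists>m>0. \<sigma> ^^ m = id" "\<And>k. \<zeta> ^^ k = id \<longleftrightarrow> n dvd k"
    "G \<subseteq> gen {\<sigma>, \<zeta>}"
    by blast
  have carrier: "\<sigma> \<in> carrier (homeo_group T)" "\<zeta> \<in> carrier (homeo_group T)"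
    using *(1,2) GH by (auto simp: homeo_group_def)
  have one: "\<one>\<^bsub>homeo_group T\<^esub> = id" by (simp add: homeo_group_def)
  \<comment> \<open>\<open>ord\<close> takes the value 0 exactly on elements of infinite
    order.\<close>
  have "group.ord (homeo_group T) \<sigma> \<noteq> 0"
    using *(3) by (auto simp: group.ord_eq_0[OF group_homeo_group carrier(1)] pow_homeo_group one)
  moreover have "group.ord (homeo_group T) \<zeta> = n"
    by (simp add: group.ord_unique[OF group_homeo_group carrier(2)] pow_homeo_group one *(4))
  moreover have "generate (homeo_group T) {\<sigma>, \<zeta>} = G"
    using *(1,2,5) GH gen_least[OF _ G_group, of "{\<sigma>, \<zeta>}"] generate_homeo_group[of "{\<sigma>, \<zeta>}" T] by auto
  ultimately show ?thesis using *(1,2) by blast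
qed

end
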